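(* Let $R=V_r$ be an admissible causal inverse on $X=C[0,T]$ and $A=R^{-1}$ with domain $\mathcal D(A)=R(X)$. Let $B_1,\dots,B_N$ be linear operators on $\mathcal D(A)$ with $B_jR=V_{q_j}$, where $q_j\in L^1(0,T)$ and $|q_j(t)|\le C_jt^{\eta_j-1}$ a.e. on $(0,T)$ for some $C_j>0$, $\eta_j>0$. Let $p_1,\dots,p_N\in C[0,T]$, $K\in C(\Delta_T)$, and $$Lu=Au+\sum_{j=1}^{N}p_j(t)B_ju(t)+\int_0^tK(t,s)u(s)\,ds,\qquad u\in\mathcal D(A).$$ Then for every $f\in C[0,T]$ the equation $Lu=f$ has a unique solution $u\in\mathcal D(A)$. If $R_L$ is the resolvent kernel generated by $$G_L(t,s)=\sum_{j=1}^{N}p_j(t)q_j(t-s)+\int_s^tK(t,\xi)r(\xi-s)\,d\xi ,$$ then $u=R(I-V_{R_L})f$. (No smallness condition on $p_j$, $K$ or $T$ is required.)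
   Context: Fix $T>0$; functions are complex-valued; $\Delta_T=\{(t,s):0\le s\le t\le T\}$. For a univariate kernel $r\in L^1(0,T)$, $(V_rf)(t)=\int_0^tr(t-s)f(s)\,ds$; for a bivariate kernel $G$, $(V_Gf)(t)=\int_0^tG(t,s)f(s)\,ds$. An admissible causal inverse is an injective convolution operator $R=V_r:C[0,T]\to C[0,T]$, $r\in L^1(0,T)$, such that $|r(t)|\le C_0t^{\eta_0-1}$ for a.e. $0<t\le T$, for some $C_0>0$, $\eta_0>0$. Resolvent kernel: for a measurable kernel $G$ on $\{0\le s<t\le T\}$ with $V_G:C[0,T]\to C[0,T]$ and $|G(t,s)|\le C(t-s)^{\eta-1}$ a.e. for some $C,\eta>0$, put $G_1=G$, $G_{n+1}(t,s)=\int_s^tG(t,\xi)G_n(\xi,s)\,d\xi$; the resolvent kernel generated by $G$ is $R_G(t,s)=\sum_{n\ge1}(-1)^{n-1}G_n(t,s)$ (the series converges absolutely for a.e. $(t,s)$, and the induced operator series converges in operator norm on $C[0,T]$ to $V_{R_G}$). *)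

theory Defs
  imports "HOL-Analysis.Analysis"
begin

text \<open>
  An element of \<open>C[0,T]\<close> is represented by its extension by zero to the whole real line, so that
  equality of functions, injectivity and uniqueness have their usual meaning on this carrier.
\<close>

definition cont_space :: "real \<Rightarrow> (real \<Rightarrow> complex) set" where
  "cont_space T = {f. continuous_on {0..T} f \<and> (\<forall>t. t \<notin> {0..T} \<longrightarrow> f t = 0)}"

definition closed_triangle :: "real \<Rightarrow> (real \<times> real) set" where
  "closed_triangle T = {(t, s). 0 \<le> s \<and> s \<le> t \<and> t \<le> T}"

definition strict_triangle :: "real \<Rightarrow> (real \<times> real) set" where
  "strict_triangle T = {(t, s). 0 \<le> s \<and> s < t \<and> t \<le> T}"

definition volterra_op ::
  "real \<Rightarrow> (real \<Rightarrow> real \<Rightarrow> complex) \<Rightarrow> (real \<Rightarrow> complex) \<Rightarrow> real \<Rightarrow> complex" where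
  "volterra_op T G f t =
     (if t \<in> {0..T} then (LINT s:{0..t}|lebesgue. G t s * f s) else 0)"

definition conv_op :: "real \<Rightarrow> (real \<Rightarrow> complex) \<Rightarrow> (real \<Rightarrow> complex) \<Rightarrow> real \<Rightarrow> complex" where
  "conv_op T r = volterra_op T (\<lambda>t s. r (t - s))"

definition power_bounded :: "real \<Rightarrow> (real \<Rightarrow> complex) \<Rightarrow> bool" where
  "power_bounded T q \<longleftrightarrow>
     (\<exists>C>0. \<exists>\<eta>>0. AE t in lebesgue. 0 < t \<and> t < T \<longrightarrow> norm (q t) \<le> C * t powr (\<eta> - 1))"

definition admissible_causal_inverse :: "real \<Rightarrow> (real \<Rightarrow> complex) \<Rightarrow> bool" where
  "admissible_causal_inverse T r \<longleftrightarrow>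
     r absolutely_integrable_on {0<..<T} \<and>
     conv_op T r ` cont_space T \<subseteq> cont_space T \<and>
     inj_on (conv_op T r) (cont_space T) \<and>
     power_bounded T r"

definition dom_A :: "real \<Rightarrow> (real \<Rightarrow> complex) \<Rightarrow> (real \<Rightarrow> complex) set" where
  "dom_A T r = conv_op T r ` cont_space T"

definition op_A :: "real \<Rightarrow> (real \<Rightarrow> complex) \<Rightarrow> (real \<Rightarrow> complex) \<Rightarrow> real \<Rightarrow> complex" where
  "op_A T r = inv_into (cont_space T) (conv_op T r)"

definition linear_operator_on ::
  "(real \<Rightarrow> complex) set \<Rightarrow> ((real \<Rightarrow> complex) \<Rightarrow> real \<Rightarrow> complex) \<Rightarrow> bool" where
  "linear_operator_on D B \<longleftrightarrow>
     (\<forall>u\<in>D. \<forall>v\<in>D. \<forall>a b. B (\<lambda>t. a * u t + b * v t) = (\<lambda>t. a * B u t + b * B v t))"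

definition op_L ::
  "real \<Rightarrow> (real \<Rightarrow> complex) \<Rightarrow> nat \<Rightarrow> (nat \<Rightarrow> real \<Rightarrow> complex)
    \<Rightarrow> (nat \<Rightarrow> (real \<Rightarrow> complex) \<Rightarrow> real \<Rightarrow> complex) \<Rightarrow> (real \<Rightarrow> real \<Rightarrow> complex)
    \<Rightarrow> (real \<Rightarrow> complex) \<Rightarrow> real \<Rightarrow> complex" where
  "op_L T r N p B K u =
     (\<lambda>t. op_A T r u t + (\<Sum>j=1..N. p j t * B j u t) + volterra_op T K u t)"

text \<open>The class of kernels for which the resolvent kernel is considered.\<close>

definition volterra_kernel :: "real \<Rightarrow> (real \<Rightarrow> real \<Rightarrow> complex) \<Rightarrow> bool" where
  "volterra_kernel T G \<longleftrightarrow>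
     (\<lambda>(t, s). G t s) \<in> borel_measurable (lebesgue_on (strict_triangle T)) \<and>
     volterra_op T G ` cont_space T \<subseteq> cont_space T \<and>
     (\<exists>C>0. \<exists>\<eta>>0. AE (t, s) in lebesgue_on (strict_triangle T).
        norm (G t s) \<le> C * (t - s) powr (\<eta> - 1))"

text \<open>Indices start at 0: \<open>iter_kernel G n\<close> is the kernel usually written \<open>G\<^sub>n\<^sub>+\<^sub>1\<close>.\<close>

primrec iter_kernel :: "(real \<Rightarrow> real \<Rightarrow> complex) \<Rightarrow> nat \<Rightarrow> real \<Rightarrow> real \<Rightarrow> complex" where
  "iter_kernel G 0 = G"
| "iter_kernel G (Suc n) = (\<lambda>t s. LINT \<xi>:{s..t}|lebesgue. G t \<xi> * iter_kernel G n \<xi> s)"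

definition resolvent_kernel :: "(real \<Rightarrow> real \<Rightarrow> complex) \<Rightarrow> real \<Rightarrow> real \<Rightarrow> complex" where
  "resolvent_kernel G t s = (\<Sum>n. (-1) ^ n * iter_kernel G n t s)"

definition kernel_GL ::
  "(real \<Rightarrow> complex) \<Rightarrow> nat \<Rightarrow> (nat \<Rightarrow> real \<Rightarrow> complex) \<Rightarrow> (nat \<Rightarrow> real \<Rightarrow> complex)
    \<Rightarrow> (real \<Rightarrow> real \<Rightarrow> complex) \<Rightarrow> real \<Rightarrow> real \<Rightarrow> complex" where
  "kernel_GL r N p q K t s =
     (\<Sum>j=1..N. p j t * q j (t - s)) + (LINT \<xi>:{s..t}|lebesgue. K t \<xi> * r (\<xi> - s))"

end

theory Submission
  imports Defs
begin

text \<open>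
  On \<open>\<D>(A) = R(C[0,T])\<close> every \<open>u\<close> is \<open>Rg\<close> for exactly one \<open>g\<close>, and \<open>Au = g\<close>. Since \<open>B\<^sub>j R = V\<^sub>q\<^sub>j\<close>,
  and since \<open>V\<^sub>K R\<close> is again a Volterra operator by Fubini's theorem, the equation \<open>Lu = f\<close> is the
  equation of the second kind \<open>g + V\<^sub>G g = f\<close> with \<open>G = G\<^sub>L\<close> (\<open>volterra_GL\<close>). Everything then comes
  down to inverting \<open>I + V\<^sub>G\<close> on \<open>C[0,T]\<close> by its Neumann series and to recognising that series as
  the operator of the resolvent kernel.

  Convergence is obtained by Bielecki's weights rather than by estimating the iterated kernels with
  Beta functions. The kernel has a majorant \<open>\<bar>G(t,s)\<bar> \<le> g(t - s)\<close> with \<open>g\<close> integrable, and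
  \<open>\<integral> \<bar>G(t,s)\<bar> e\<^sup>\<beta>\<^sup>s ds \<le> e\<^sup>\<beta>\<^sup>t \<integral> g(x) e\<^sup>-\<^sup>\<beta>\<^sup>x dx\<close>, where the last integral tends to 0 as \<open>\<beta>\<close> grows
  (\<open>convolution_majorant_imp_contraction\<close>). In the weighted norm \<open>V\<^sub>G\<close> is therefore a contraction
  whatever the size of the coefficients and of \<open>T\<close>. The same bound for \<open>\<bar>G\<bar>\<close> propagates by Tonelli
  to the iterated kernels with geometric decay (\<open>kernel_power_contraction\<close>), which gives at once the
  convergence of the kernel series almost everywhere in each row, the exchange of sum and integral,
  and uniform convergence on \<open>[0,T]\<close>, hence continuity of the solution. Uniqueness together with the
  solution formula is a telescoping sum (\<open>neumann_inverse_unique\<close>), existence an index shift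
  (\<open>neumann_inverse_exists\<close>).

  The remaining work is measure-theoretic. The functions \<open>r\<close> and \<open>q\<^sub>j\<close> matter only up to
  null sets, whereas the iterated kernels are defined pointwise. Borel
  representatives are used throughout, and \<open>iter_kernel_eq_kernel_power\<close> shows that the change on
  null sets does not affect the resolvent operator.
\<close>

section \<open>The Neumann series of a contracting kernel\<close>

text \<open>
  Kernels are taken on the whole plane and integrated against Borel-Lebesgue measure on the line.
  Causality is then a matter of where a kernel vanishes, and iterated integrals are governed by
  Tonelli and Fubini without moving limits of integration.
\<close>

definition kernel_op :: "(real \<Rightarrow> real \<Rightarrow> complex) \<Rightarrow> (real \<Rightarrow> complex) \<Rightarrow> real \<Rightarrow> complex" where
  "kernel_op G h t = (LINT s|lborel. G t s * h s)"

primrec kernel_power :: "(real \<Rightarrow> real \<Rightarrow> complex) \<Rightarrow> nat \<Rightarrow> real \<Rightarrow> real \<Rightarrow> complex" where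
  "kernel_power G 0 = G"
| "kernel_power G (Suc n) = (\<lambda>t s. LINT \<xi>|lborel. G t \<xi> * kernel_power G n \<xi> s)"

lemma norm_integral_le_nn_integral:
  fixes f :: "'a \<Rightarrow> 'b::{banach, second_countable_topology}"
  shows "ennreal (norm (integral\<^sup>L M f)) \<le> (\<integral>\<^sup>+x. norm (f x) \<partial>M)"
  by (cases "integrable M f") (auto simp: integral_norm_bound_ennreal not_integrable_integral_eq)

lemma kernel_op_measurable [measurable]:
  assumes [measurable]: "case_prod G \<in> borel_measurable (borel \<Otimes>\<^sub>M borel)" "h \<in> borel_measurable borel"
  shows "kernel_op G h \<in> borel_measurable borel"
  unfolding kernel_op_def by measurable

text \<open>
  Fubini's theorem for \<open>\<integral>\<integral> A(t,\<xi>) B(\<xi>,s) h(s)\<close> at a fixed \<open>t\<close>. It serves twice: it identifies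
  the operator of an iterated kernel with a power of the operator, and the convolution by \<open>r\<close>
  followed by \<open>K\<close> with the operator of the second term of \<open>G\<^sub>L\<close>.
\<close>

lemma kernel_op_compose:
  assumes [measurable]: "case_prod A \<in> borel_measurable (borel \<Otimes>\<^sub>M borel)"
      "case_prod B \<in> borel_measurable (borel \<Otimes>\<^sub>M borel)" "h \<in> borel_measurable borel"
    and fin: "(\<integral>\<^sup>+\<xi>. norm (A t \<xi>) * (\<integral>\<^sup>+s. norm (B \<xi> s * h s) \<partial>lborel) \<partial>lborel) < \<infinity>"
  shows "kernel_op (\<lambda>t s. LINT \<xi>|lborel. A t \<xi> * B \<xi> s) h t = kernel_op A (kernel_op B h) t"
proof -
  let ?f = "\<lambda>\<xi> s. A t \<xi> * (B \<xi> s * h s)"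
  have "integrable (lborel \<Otimes>\<^sub>M lborel) (case_prod ?f)"
  proof (rule integrableI_bounded)
    have "(\<integral>\<^sup>+x. norm (case_prod ?f x) \<partial>(lborel \<Otimes>\<^sub>M lborel)) =
        (\<integral>\<^sup>+\<xi>. \<integral>\<^sup>+s. norm (A t \<xi>) * ennreal (norm (B \<xi> s * h s)) \<partial>lborel \<partial>lborel)"
      by (subst lborel.nn_integral_fst[symmetric]) (auto simp: norm_mult ennreal_mult)
    also have "\<dots> < \<infinity>"
      using fin by (subst nn_integral_cmult) auto
    finally show "(\<integral>\<^sup>+x. norm (case_prod ?f x) \<partial>(lborel \<Otimes>\<^sub>M lborel)) < \<infinity>" .
  qed measurable
  from lborel_pair.Fubini_integral[OF this] show ?thesis
    by (simp add: kernel_op_def mult.assoc flip: integral_mult_left_zero integral_mult_right_zero)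
qed

lemma kernel_power_measurable:
  assumes [measurable]: "case_prod G \<in> borel_measurable (borel \<Otimes>\<^sub>M borel)"
  shows "case_prod (kernel_power G n) \<in> borel_measurable (borel \<Otimes>\<^sub>M borel)"
proof (induction n)
  case (Suc n)
  note Suc [measurable]
  show ?case by simp measurable
qed simp

definition neumann_kernel :: "(real \<Rightarrow> real \<Rightarrow> complex) \<Rightarrow> real \<Rightarrow> real \<Rightarrow> complex" where
  "neumann_kernel G t s = (\<Sum>n. (-1) ^ n * kernel_power G n t s)"

text \<open>
  Bielecki's device. In the norm \<open>sup \<bar>h\<bar> / \<phi>\<close> the operator of \<open>G\<close> has norm at most \<open>\<rho> < 1\<close>, and
  the hypothesis below says this for \<open>\<bar>G\<bar>\<close>, so that it also controls the series of kernels and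
  not only the series of operators.
\<close>

locale weighted_contraction_kernel =
  fixes G :: "real \<Rightarrow> real \<Rightarrow> complex" and \<phi> :: "real \<Rightarrow> real" and \<rho> :: real
  assumes kernel_meas [measurable]: "case_prod G \<in> borel_measurable (borel \<Otimes>\<^sub>M borel)"
    and weight_meas [measurable]: "\<phi> \<in> borel_measurable borel"
    and weight_pos: "\<And>t. 0 < \<phi> t"
    and rho: "0 \<le> \<rho>" "\<rho> < 1"
    and contraction: "\<And>t. (\<integral>\<^sup>+s. ennreal (norm (G t s) * \<phi> s) \<partial>lborel) \<le> ennreal (\<rho> * \<phi> t)"
begin

definition weight_bounded :: "(real \<Rightarrow> complex) \<Rightarrow> bool" where
  "weight_bounded h \<longleftrightarrow> h \<in> borel_measurable borel \<and> (\<exists>M. \<forall>s. norm (h s) \<le> M * \<phi> s)"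

lemma weight_boundedE:
  assumes "weight_bounded h"
  obtains M where "0 \<le> M" "\<And>s. norm (h s) \<le> M * \<phi> s" "h \<in> borel_measurable borel"
proof -
  from assms obtain M where M: "\<And>s. norm (h s) \<le> M * \<phi> s" and "h \<in> borel_measurable borel"
    unfolding weight_bounded_def by blast
  moreover have "0 \<le> M"
    using M[of 0] weight_pos[of 0] norm_ge_zero[of "h 0"]
    by (meson order_trans zero_le_mult_iff not_le)
  ultimately show ?thesis using that by blast
qed

lemmas kernel_power_meas [measurable] = kernel_power_measurable[OF kernel_meas]

text \<open>
  The bound on the iterated kernels is geometric because, by Tonelli, the weighted row integral of
  \<open>\<bar>G\<^sub>n\<^sub>+\<^sub>1\<bar>\<close> is at most that of \<open>\<bar>G\<bar>\<close> applied to the weighted row integral of \<open>\<bar>G\<^sub>n\<bar>\<close>.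
\<close>

lemma kernel_power_contraction:
  "(\<integral>\<^sup>+s. ennreal (norm (kernel_power G n t s) * \<phi> s) \<partial>lborel) \<le> ennreal (\<rho> ^ Suc n * \<phi> t)"
proof (induction n arbitrary: t)
  case 0
  then show ?case using contraction by simp
next
  case (Suc n)
  have "(\<integral>\<^sup>+s. ennreal (norm (kernel_power G (Suc n) t s) * \<phi> s) \<partial>lborel)
      \<le> (\<integral>\<^sup>+s. \<integral>\<^sup>+\<xi>. ennreal (norm (G t \<xi>)) * ennreal (norm (kernel_power G n \<xi> s) * \<phi> s) \<partial>lborel \<partial>lborel)"
  proof (rule nn_integral_mono)
    fix s
    have "ennreal (norm (kernel_power G (Suc n) t s) * \<phi> s) =
        ennreal (norm (LINT \<xi>|lborel. G t \<xi> * kernel_power G n \<xi> s)) * ennreal (\<phi> s)"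
      by (simp add: ennreal_mult' less_imp_le[OF weight_pos])
    also have "\<dots> \<le> (\<integral>\<^sup>+\<xi>. norm (G t \<xi> * kernel_power G n \<xi> s) \<partial>lborel) * ennreal (\<phi> s)"
      by (intro mult_right_mono norm_integral_le_nn_integral) simp
    also have "\<dots> = (\<integral>\<^sup>+\<xi>. ennreal (norm (G t \<xi>)) * ennreal (norm (kernel_power G n \<xi> s) * \<phi> s) \<partial>lborel)"
      by (subst nn_integral_multc[symmetric])
         (auto simp: norm_mult ennreal_mult less_imp_le[OF weight_pos] mult.assoc)
    finally show "ennreal (norm (kernel_power G (Suc n) t s) * \<phi> s) \<le> \<dots>" .
  qed
  also have "\<dots> = (\<integral>\<^sup>+\<xi>. \<integral>\<^sup>+s. ennreal (norm (G t \<xi>)) * ennreal (norm (kernel_power G n \<xi> s) * \<phi> s) \<partial>lborel \<partial>lborel)"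
    by (rule lborel_pair.Fubini') measurable
  also have "\<dots> = (\<integral>\<^sup>+\<xi>. ennreal (norm (G t \<xi>)) * (\<integral>\<^sup>+s. ennreal (norm (kernel_power G n \<xi> s) * \<phi> s) \<partial>lborel) \<partial>lborel)"
    by (intro nn_integral_cong nn_integral_cmult) measurable
  also have "\<dots> \<le> (\<integral>\<^sup>+\<xi>. ennreal (norm (G t \<xi>)) * ennreal (\<rho> ^ Suc n * \<phi> \<xi>) \<partial>lborel)"
    by (intro nn_integral_mono mult_left_mono Suc) simp
  also have "\<dots> = ennreal (\<rho> ^ Suc n) * (\<integral>\<^sup>+\<xi>. ennreal (norm (G t \<xi>) * \<phi> \<xi>) \<partial>lborel)"
    by (subst nn_integral_cmult[symmetric])
       (auto simp: ennreal_mult[symmetric] rho less_imp_le[OF weight_pos] mult_ac intro!: nn_integral_cong)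
  also have "\<dots> \<le> ennreal (\<rho> ^ Suc n) * ennreal (\<rho> * \<phi> t)"
    by (intro mult_left_mono contraction) simp
  also have "\<dots> = ennreal (\<rho> ^ Suc (Suc n) * \<phi> t)"
    by (simp add: ennreal_mult[symmetric] rho less_imp_le[OF weight_pos] mult_ac)
  finally show ?case .
qed

lemma kernel_power_nn_bound:
  assumes M: "0 \<le> M" "\<And>s. norm (h s) \<le> M * \<phi> s" and [measurable]: "h \<in> borel_measurable borel"
  shows "(\<integral>\<^sup>+s. ennreal (norm (kernel_power G n t s * h s)) \<partial>lborel) \<le> ennreal (M * \<rho> ^ Suc n * \<phi> t)"
proof -
  have "(\<integral>\<^sup>+s. ennreal (norm (kernel_power G n t s * h s)) \<partial>lborel)
      \<le> (\<integral>\<^sup>+s. ennreal M * ennreal (norm (kernel_power G n t s) * \<phi> s) \<partial>lborel)"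
  proof (rule nn_integral_mono)
    fix s
    have "norm (kernel_power G n t s * h s) \<le> norm (kernel_power G n t s) * (M * \<phi> s)"
      unfolding norm_mult by (intro mult_left_mono M) simp
    then show "ennreal (norm (kernel_power G n t s * h s)) \<le> ennreal M * ennreal (norm (kernel_power G n t s) * \<phi> s)"
      using M(1) weight_pos[of s] by (simp add: ennreal_mult[symmetric] mult_ac ennreal_leI)
  qed
  also have "\<dots> = ennreal M * (\<integral>\<^sup>+s. ennreal (norm (kernel_power G n t s) * \<phi> s) \<partial>lborel)"
    by (rule nn_integral_cmult) measurable
  also have "\<dots> \<le> ennreal M * ennreal (\<rho> ^ Suc n * \<phi> t)"
    by (intro mult_left_mono kernel_power_contraction) simp
  also have "\<dots> = ennreal (M * \<rho> ^ Suc n * \<phi> t)"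
    using M(1) weight_pos[of t] rho by (simp add: ennreal_mult[symmetric] mult_ac)
  finally show ?thesis .
qed

lemma integrable_kernel_power:
  assumes "weight_bounded h"
  shows "integrable lborel (\<lambda>s. kernel_power G n t s * h s)"
proof -
  from assms obtain M where M: "0 \<le> M" "\<And>s. norm (h s) \<le> M * \<phi> s"
    and [measurable]: "h \<in> borel_measurable borel" by (rule weight_boundedE) blast
  show ?thesis
    by (rule integrableI_bounded, measurable)
       (rule le_less_trans[OF kernel_power_nn_bound[OF M]], auto)
qed

lemma integral_norm_kernel_power_le:
  assumes M: "0 \<le> M" "\<And>s. norm (h s) \<le> M * \<phi> s" and [measurable]: "h \<in> borel_measurable borel"
  shows "(LINT s|lborel. norm (kernel_power G n t s * h s)) \<le> M * \<rho> ^ Suc n * \<phi> t"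
proof -
  have "weight_bounded h" using M unfolding weight_bounded_def by auto
  then have "ennreal (LINT s|lborel. norm (kernel_power G n t s * h s)) \<le> ennreal (M * \<rho> ^ Suc n * \<phi> t)"
    using kernel_power_nn_bound[OF M, of n t] integrable_norm[OF integrable_kernel_power, of h n t]
    by (subst nn_integral_eq_integral[symmetric]) auto
  then show ?thesis
    using M(1) rho weight_pos[of t] by (subst (asm) ennreal_le_iff) auto
qed

lemma norm_kernel_op_power_le:
  assumes M: "0 \<le> M" "\<And>s. norm (h s) \<le> M * \<phi> s" and [measurable]: "h \<in> borel_measurable borel"
  shows "norm (kernel_op (kernel_power G n) h t) \<le> M * \<rho> ^ Suc n * \<phi> t"
  using integral_norm_kernel_power_le[OF assms, of n t] integral_norm_bound[of lborel "\<lambda>s. kernel_power G n t s * h s"]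
  unfolding kernel_op_def by linarith

lemma weight_bounded_kernel_op_power:
  assumes "weight_bounded h"
  shows "weight_bounded (kernel_op (kernel_power G n) h)"
proof -
  from assms obtain M where M: "0 \<le> M" "\<And>s. norm (h s) \<le> M * \<phi> s"
    and [measurable]: "h \<in> borel_measurable borel" by (rule weight_boundedE) blast
  have "\<forall>t. norm (kernel_op (kernel_power G n) h t) \<le> (M * \<rho> ^ Suc n) * \<phi> t"
    using norm_kernel_op_power_le[OF M] by simp
  then show ?thesis unfolding weight_bounded_def by (intro conjI exI) measurable
qed

lemma weight_bounded_kernel_op: "weight_bounded h \<Longrightarrow> weight_bounded (kernel_op G h)"
  using weight_bounded_kernel_op_power[of h 0] by simp

lemma kernel_op_power_Suc:
  assumes "weight_bounded h"
  shows "kernel_op (kernel_power G (Suc n)) h t = kernel_op G (kernel_op (kernel_power G n) h) t"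
proof -
  from assms obtain M where M: "0 \<le> M" "\<And>s. norm (h s) \<le> M * \<phi> s"
    and [measurable]: "h \<in> borel_measurable borel" by (rule weight_boundedE) blast
  have "(\<integral>\<^sup>+\<xi>. norm (G t \<xi>) * (\<integral>\<^sup>+s. norm (kernel_power G n \<xi> s * h s) \<partial>lborel) \<partial>lborel)
      \<le> (\<integral>\<^sup>+\<xi>. norm (G t \<xi>) * ennreal (M * \<rho> ^ Suc n * \<phi> \<xi>) \<partial>lborel)"
    by (intro nn_integral_mono mult_left_mono kernel_power_nn_bound M) auto
  also have "\<dots> = ennreal (M * \<rho> ^ Suc n) * (\<integral>\<^sup>+\<xi>. ennreal (norm (G t \<xi>) * \<phi> \<xi>) \<partial>lborel)"
    by (subst nn_integral_cmult[symmetric])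
       (auto simp: ennreal_mult[symmetric] rho M(1) less_imp_le[OF weight_pos] mult_ac intro!: nn_integral_cong)
  also have "\<dots> < \<infinity>"
    using le_less_trans[OF contraction[of t] ennreal_less_top] by (simp add: ennreal_mult_less_top)
  finally show ?thesis
    by (simp only: kernel_power.simps) (rule kernel_op_compose; measurable)
qed

text \<open>
  Powers of the operator commute with it. This form, with the new factor innermost, is the one that
  makes the Neumann series of \<open>g + V\<^sub>G g\<close> telescope.
\<close>

lemma kernel_op_power_Suc':
  assumes "weight_bounded h"
  shows "kernel_op (kernel_power G (Suc n)) h t = kernel_op (kernel_power G n) (kernel_op G h) t"
proof (induction n arbitrary: t)
  case 0
  show ?case using kernel_op_power_Suc[OF assms, of 0 t] by simp
next
  case (Suc n)
  have "kernel_op (kernel_power G (Suc n)) h = kernel_op (kernel_power G n) (kernel_op G h)"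
    using Suc by blast
  then show ?case
    using kernel_op_power_Suc[OF assms, of "Suc n" t]
      kernel_op_power_Suc[OF weight_bounded_kernel_op[OF assms], of n t] by simp
qed

lemma summable_geometric_weight: "summable (\<lambda>n. M * \<rho> ^ Suc n * \<phi> t)"
  using rho by (auto intro!: summable_mult summable_mult2 summable_geometric)

text \<open>
  The weighted row integrals of the \<open>\<bar>G\<^sub>n\<bar>\<close> have a finite sum, so in each row the sum of the
  \<open>\<bar>G\<^sub>n\<bar>\<close> itself is finite almost everywhere.
\<close>

lemma AE_summable_kernel_power:
  "AE s in lborel. summable (\<lambda>n. norm (kernel_power G n t s))"
proof -
  let ?F = "\<lambda>s. \<Sum>n. ennreal (norm (kernel_power G n t s) * \<phi> s)"
  have "(\<integral>\<^sup>+s. ?F s \<partial>lborel) = (\<Sum>n. \<integral>\<^sup>+s. ennreal (norm (kernel_power G n t s) * \<phi> s) \<partial>lborel)"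
    by (rule nn_integral_suminf) measurable
  also have "\<dots> \<le> (\<Sum>n. ennreal (1 * \<rho> ^ Suc n * \<phi> t))"
    using kernel_power_contraction by (intro suminf_le) auto
  also have "\<dots> = ennreal (\<Sum>n. 1 * \<rho> ^ Suc n * \<phi> t)"
    using rho weight_pos[of t] summable_geometric_weight[of 1 t] by (intro suminf_ennreal2) auto
  finally have "(\<integral>\<^sup>+s. ?F s \<partial>lborel) \<noteq> \<infinity>"
    using ennreal_less_top by (auto simp: top_unique)
  moreover have "?F \<in> borel_measurable lborel" by measurable
  ultimately have "AE s in lborel. ?F s \<noteq> \<infinity>"
    by (intro nn_integral_PInf_AE)
  then show ?thesis
  proof (rule AE_mp, intro AE_I2 impI)
    fix s assume "?F s \<noteq> \<infinity>"
    then have "summable (\<lambda>n. norm (kernel_power G n t s) * \<phi> s)"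
      using weight_pos[of s] by (intro summable_suminf_not_top) auto
    then show "summable (\<lambda>n. norm (kernel_power G n t s))"
      using summable_mult2[of _ "inverse (\<phi> s)"] weight_pos[of s]
      by (fastforce simp: mult.assoc)
  qed
qed

lemma neumann_kernel_op_sums:
  assumes "weight_bounded h"
  shows "(\<lambda>n. (-1) ^ n * kernel_op (kernel_power G n) h t) sums kernel_op (neumann_kernel G) h t"
proof -
  from assms obtain M where M: "0 \<le> M" "\<And>s. norm (h s) \<le> M * \<phi> s"
    and [measurable]: "h \<in> borel_measurable borel" by (rule weight_boundedE) blast
  let ?f = "\<lambda>n s. (-1) ^ n * kernel_power G n t s * h s"
  have norm_f: "norm (?f n s) = norm (kernel_power G n t s * h s)" for n s
    by (simp add: norm_mult norm_power)
  have int: "integrable lborel (?f n)" for n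
    using integrable_mult_right[OF integrable_kernel_power[OF assms, of n t], of "(-1) ^ n"]
    by (simp add: mult.assoc)
  have ae: "AE s in lborel. summable (\<lambda>n. norm (?f n s))"
    using AE_summable_kernel_power[of t]
  proof eventually_elim
    case (elim s)
    then show ?case unfolding norm_f unfolding norm_mult by (rule summable_mult2)
  qed
  have "summable (\<lambda>n. LINT s|lborel. norm (?f n s))"
  proof (rule summable_comparison_test'[OF summable_geometric_weight[of M t]])
    fix n
    show "norm (LINT s|lborel. norm (?f n s)) \<le> M * \<rho> ^ Suc n * \<phi> t"
      unfolding norm_f using integral_norm_kernel_power_le[OF M, of n t] by simp
  qed
  note sums_integral[OF int ae this]
  moreover have "(LINT s|lborel. (\<Sum>n. ?f n s)) = kernel_op (neumann_kernel G) h t"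
    unfolding kernel_op_def neumann_kernel_def
  proof (rule integral_cong_AE)
    show "AE s in lborel. (\<Sum>n. ?f n s) = (\<Sum>n. (-1) ^ n * kernel_power G n t s) * h s"
      using AE_summable_kernel_power[of t]
    proof eventually_elim
      case (elim s)
      then have "summable (\<lambda>n. norm ((-1) ^ n * kernel_power G n t s))"
        by (simp add: norm_mult norm_power)
      then have "summable (\<lambda>n. (-1) ^ n * kernel_power G n t s)"
        by (rule summable_norm_cancel)
      then show ?case by (rule suminf_mult2[symmetric])
    qed
  qed measurable
  moreover have "(LINT s|lborel. ?f n s) = (-1) ^ n * kernel_op (kernel_power G n) h t" for n
    unfolding kernel_op_def by (simp add: mult.assoc)
  ultimately show ?thesis by simp
qed

text \<open>
  The Neumann series of \<open>f = g + V\<^sub>G g\<close> has the general term \<open>a\<^sub>n - a\<^sub>n\<^sub>+\<^sub>1\<close> with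
  \<open>a\<^sub>n = (-1)\<^sup>n V\<^sub>G\<^sup>n\<^sup>+\<^sup>1 g\<close>, and \<open>a\<^sub>n\<close> tends to 0; only \<open>a\<^sub>0 = V\<^sub>G g\<close> survives. Every solution
  \<open>g\<close> is thereby expressed through \<open>f\<close>.
\<close>

lemma neumann_inverse_unique:
  assumes g: "weight_bounded g"
  shows "kernel_op (neumann_kernel G) (\<lambda>s. g s + kernel_op G g s) t = kernel_op G g t"
proof -
  from g obtain M where M: "0 \<le> M" "\<And>s. norm (g s) \<le> M * \<phi> s"
    and [measurable]: "g \<in> borel_measurable borel" by (rule weight_boundedE) blast
  note g' = weight_bounded_kernel_op[OF g]
  let ?f = "\<lambda>s. g s + kernel_op G g s"
  from g' obtain M' where M': "\<And>s. norm (kernel_op G g s) \<le> M' * \<phi> s"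
    by (rule weight_boundedE) blast
  have f: "weight_bounded ?f"
    unfolding weight_bounded_def
  proof (intro conjI exI allI)
    show "norm (?f s) \<le> (M + M') * \<phi> s" for s
      using norm_triangle_ineq[of "g s" "kernel_op G g s"] M(2)[of s] M'[of s] by (simp add: distrib_right)
  qed measurable
  let ?a = "\<lambda>n. (-1) ^ n * kernel_op (kernel_power G n) g t"
  have "(-1) ^ n * kernel_op (kernel_power G n) ?f t = ?a n - ?a (Suc n)" for n
  proof -
    have "kernel_op (kernel_power G n) ?f t =
        kernel_op (kernel_power G n) g t + kernel_op (kernel_power G n) (kernel_op G g) t"
      unfolding kernel_op_def[of "kernel_power G n"] distrib_left
      by (intro Bochner_Integration.integral_add integrable_kernel_power g g')
    then show ?thesis
      unfolding kernel_op_power_Suc'[OF g] by (simp add: distrib_left)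
  qed
  then have "(\<lambda>n. ?a n - ?a (Suc n)) sums kernel_op (neumann_kernel G) ?f t"
    using neumann_kernel_op_sums[OF f, of t] by simp
  moreover have "?a \<longlonglongrightarrow> 0"
  proof (rule Lim_null_comparison)
    show "\<forall>\<^sub>F n in sequentially. norm (?a n) \<le> M * \<rho> ^ Suc n * \<phi> t"
      using norm_kernel_op_power_le[OF M] by (simp add: norm_mult norm_power)
    show "(\<lambda>n. M * \<rho> ^ Suc n * \<phi> t) \<longlonglongrightarrow> 0"
      by (rule summable_LIMSEQ_zero[OF summable_geometric_weight])
  qed
  then have "(\<lambda>n. ?a n - ?a (Suc n)) sums (?a 0 - 0)"
    by (rule telescope_sums')
  ultimately show ?thesis using sums_unique2 by fastforce
qed

text \<open>
  Applying \<open>V\<^sub>G\<close> term by term shifts the Neumann series \<open>S\<close> of \<open>f\<close> by one index and flips its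
  signs, whence \<open>V\<^sub>G S = V\<^sub>G f - S\<close>; so \<open>g = f - S\<close> solves \<open>g + V\<^sub>G g = f\<close>.
\<close>

lemma neumann_inverse_exists:
  assumes f: "weight_bounded f"
  shows "kernel_op G (\<lambda>s. f s - kernel_op (neumann_kernel G) f s) t = kernel_op (neumann_kernel G) f t"
proof -
  from f obtain M where M: "0 \<le> M" "\<And>s. norm (f s) \<le> M * \<phi> s"
    and [measurable]: "f \<in> borel_measurable borel" by (rule weight_boundedE) blast
  let ?W = "\<lambda>n. kernel_op (kernel_power G n) f"
  let ?S = "kernel_op (neumann_kernel G) f"
  have S: "(\<lambda>n. (-1) ^ n * ?W n s) sums ?S s" for s
    by (rule neumann_kernel_op_sums[OF f])
  let ?F = "\<lambda>n s. (-1) ^ n * (G t s * ?W n s)"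
  have Wb: "weight_bounded (?W n)" for n by (rule weight_bounded_kernel_op_power[OF f])
  have W_bd: "norm (?W n s) \<le> (M * \<rho> ^ Suc n) * \<phi> s" for n s
    using norm_kernel_op_power_le[OF M] by simp
  have int: "integrable lborel (?F n)" for n
    using integrable_kernel_power[OF Wb, of 0] by simp
  have ae: "AE s in lborel. summable (\<lambda>n. norm (?F n s))"
  proof (rule AE_I2)
    fix s
    have "summable (\<lambda>n. norm (?W n s))"
      by (rule summable_comparison_test'[OF summable_geometric_weight[of M s]]) (use W_bd in simp)
    then have "summable (\<lambda>n. norm (G t s) * norm (?W n s))" by (rule summable_mult)
    then show "summable (\<lambda>n. norm (?F n s))" by (simp add: norm_mult norm_power)
  qed
  have "summable (\<lambda>n. LINT s|lborel. norm (?F n s))"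
  proof (rule summable_comparison_test'[OF summable_geometric_weight[of "M * \<rho>" t]])
    fix n
    have "(LINT s|lborel. norm (G t s * ?W n s)) \<le> M * \<rho> ^ Suc n * \<rho> ^ Suc 0 * \<phi> t"
      using integral_norm_kernel_power_le[OF _ W_bd, of n 0 t] M rho by simp
    then show "norm (LINT s|lborel. norm (?F n s)) \<le> M * \<rho> * \<rho> ^ Suc n * \<phi> t"
      by (simp add: norm_mult norm_power mult_ac)
  qed
  note sums_integral[OF int ae this]
  moreover have "(\<Sum>n. ?F n s) = G t s * ?S s" for s
    using sums_mult[OF S[of s], of "G t s"] by (simp add: sums_iff mult_ac)
  moreover have "(LINT s|lborel. ?F n s) = (-1) ^ n * ?W (Suc n) t" for n
    unfolding kernel_op_power_Suc[OF f] unfolding kernel_op_def[of G] by simp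
  ultimately have "(\<lambda>n. (-1) ^ n * ?W (Suc n) t) sums kernel_op G ?S t"
    by (simp add: kernel_op_def[of G])
  then have "(\<lambda>n. - ((-1) ^ n * ?W (Suc n) t)) sums - kernel_op G ?S t"
    by (rule sums_minus)
  then have "(\<lambda>n. (-1) ^ (Suc n) * ?W (Suc n) t) sums - kernel_op G ?S t"
    by simp
  then have "(\<lambda>n. (-1) ^ n * ?W n t) sums (- kernel_op G ?S t + kernel_op G f t)"
    by (subst (asm) sums_Suc_iff) simp
  with S[of t] have eq: "?S t = kernel_op G f t - kernel_op G ?S t"
    using sums_unique2 by fastforce
  have Sb: "integrable lborel (\<lambda>s. G t s * ?S s)"
    using integrable_suminf[OF int ae \<open>summable (\<lambda>n. LINT s|lborel. norm (?F n s))\<close>]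
    by (simp add: \<open>\<And>s. (\<Sum>n. ?F n s) = G t s * ?S s\<close>)
  have "kernel_op G (\<lambda>s. f s - ?S s) t = kernel_op G f t - kernel_op G ?S t"
    unfolding kernel_op_def[of G] right_diff_distrib
    by (intro Bochner_Integration.integral_diff Sb) (use integrable_kernel_power[OF f, of 0] in simp)
  with eq show ?thesis by simp
qed

lemma continuous_on_neumann:
  assumes f: "weight_bounded f"
    and cont: "\<And>n. continuous_on S (kernel_op (kernel_power G n) f)"
    and bd: "\<And>t. t \<in> S \<Longrightarrow> \<phi> t \<le> C"
  shows "continuous_on S (kernel_op (neumann_kernel G) f)"
proof -
  from f obtain M where M: "0 \<le> M" "\<And>s. norm (f s) \<le> M * \<phi> s"
    and [measurable]: "f \<in> borel_measurable borel" by (rule weight_boundedE) blast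
  let ?f = "\<lambda>n t. (-1) ^ n * kernel_op (kernel_power G n) f t"
  have "uniform_limit S (\<lambda>n t. \<Sum>i<n. ?f i t) (\<lambda>t. \<Sum>i. ?f i t) sequentially"
  proof (rule Weierstrass_m_test)
    show "summable (\<lambda>n. M * \<rho> ^ Suc n * C)"
      using rho by (auto intro!: summable_mult summable_mult2 summable_geometric)
    fix n t assume "t \<in> S"
    then have "M * \<rho> ^ Suc n * \<phi> t \<le> M * \<rho> ^ Suc n * C"
      using M(1) rho by (intro mult_left_mono bd) auto
    then show "norm (?f n t) \<le> M * \<rho> ^ Suc n * C"
      using norm_kernel_op_power_le[OF M, of n t] by (simp add: norm_mult norm_power)
  qed
  then have "continuous_on S (\<lambda>t. \<Sum>i. ?f i t)"
    by (rule uniform_limit_theorem[rotated])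
       (auto intro!: always_eventually continuous_on_sum continuous_on_mult cont)
  then show ?thesis
    using sums_unique[OF neumann_kernel_op_sums[OF f]] by simp
qed

end

section \<open>From Lebesgue to Borel representatives\<close>

text \<open>
  The bridge between the integrals of the statement, taken over Lebesgue measure and over moving
  intervals, and integrals of Borel functions over the line. Measurability of \<open>f\<close> on \<open>S\<close> comes
  from the completeness of Lebesgue measure.
\<close>

lemma set_integral_lebesgue_eq_lborel:
  fixes f h :: "real \<Rightarrow> complex"
  assumes [measurable]: "h \<in> borel_measurable borel"
    and ae: "AE x in lborel. x \<in> S \<longrightarrow> f x = h x"
    and zero: "\<And>x. x \<notin> S \<Longrightarrow> h x = 0"
  shows "(LINT x:S|lebesgue. f x) = (LINT x|lborel. h x)"
proof -
  have h: "h \<in> borel_measurable lebesgue" by (rule measurable_completion) simp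
  have "AE x in lborel. h x = indicator S x *\<^sub>R f x"
    using ae by eventually_elim (auto simp: indicator_def zero)
  then have eq: "AE x in lebesgue. h x = indicator S x *\<^sub>R f x" by (rule AE_completion)
  have "(LINT x|lebesgue. indicator S x *\<^sub>R f x) = (LINT x|lebesgue. h x)"
    using eq by (intro integral_cong_AE borel_measurable_AE[OF h eq] h) (auto elim: eventually_mono)
  also have "\<dots> = (LINT x|lborel. h x)" by (rule integral_completion) simp
  finally show ?thesis by (simp add: set_lebesgue_integral_def)
qed

lemma AE_lborel_affine:
  fixes P :: "real \<Rightarrow> bool"
  assumes "AE x in lborel. P x" "c \<noteq> 0"
  shows "AE x in lborel. P (t + c * x)"
proof -
  from assms obtain N where N: "{x. \<not> P x} \<subseteq> N" "N \<in> null_sets lborel"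
    by (auto simp: eventually_ae_filter)
  then have "AE x in lborel. x \<notin> N" by (intro AE_not_in)
  moreover have [measurable]: "N \<in> sets borel" using N(2) by auto
  ultimately have "AE x in lborel. t + c * x \<notin> N"
    using assms(2) by (intro AE_borel_affine) auto
  then show ?thesis by eventually_elim (use N(1) in auto)
qed

lemma AE_lborel_reflect: "AE x in lborel. P x \<Longrightarrow> AE s in lborel. P (t - s)" for t :: real
  using AE_lborel_affine[of P "-1" t] by simp

lemma AE_lborel_translate: "AE x in lborel. P x \<Longrightarrow> AE t in lborel. P (t - s)" for s :: real
  using AE_lborel_affine[of P 1 "- s"] by simp

text \<open>
  A null set of the line has a null preimage under \<open>(t,s) \<mapsto> t - s\<close>, because each row of the preimage
  is a reflected translate of it. A Borel null superset makes the preimage measurable.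
\<close>

lemma AE_lborel_difference:
  fixes P :: "real \<Rightarrow> bool"
  assumes "AE x in lborel. P x"
  shows "AE (t, s) in lborel. P (t - s)"
proof -
  from assms obtain N where N: "{x. \<not> P x} \<subseteq> N" "N \<in> null_sets lborel"
    by (auto simp: eventually_ae_filter)
  then have ae: "AE x in lborel. x \<notin> N" by (intro AE_not_in)
  have [measurable]: "N \<in> sets borel" using N(2) by auto
  have "AE z in lborel \<Otimes>\<^sub>M lborel. fst z - snd z \<notin> N"
  proof (rule lborel_pair.AE_pair_measure)
    show "AE t in lborel. AE s in lborel. fst (t, s) - snd (t, s) \<notin> N"
      using AE_lborel_reflect[OF ae] by simp
  qed measurable
  then show ?thesis
    unfolding lborel_prod by eventually_elim (use N(1) in auto)
qed

text \<open>
  A function that is merely Lebesgue measurable is awkward under the integral sign once it depends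
  on a difference of two variables; passing to a Borel representative, cut off outside \<open>(0,T)\<close>,
  turns every later measurability question into a routine one.
\<close>

lemma borel_representative:
  fixes r :: "real \<Rightarrow> complex"
  assumes "r absolutely_integrable_on {0<..<T}"
  obtains r' where "integrable lborel r'" "\<And>x. x \<notin> {0<..<T} \<Longrightarrow> r' x = 0"
    "AE x in lborel. x \<in> {0<..<T} \<longrightarrow> r x = r' x"
proof -
  let ?r = "\<lambda>x. indicator {0<..<T} x *\<^sub>R r x"
  have int: "integrable lebesgue ?r"
    using assms by (simp add: set_integrable_def)
  then have "?r \<in> borel_measurable lebesgue" by (rule borel_measurable_integrable)
  then have "(\<lambda>x. Re (?r x)) \<in> borel_measurable lebesgue" "(\<lambda>x. Im (?r x)) \<in> borel_measurable lebesgue"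
    by measurable
  from this[THEN completion_ex_borel_measurable_real]
  obtain a b where [measurable]: "a \<in> borel_measurable lborel" "b \<in> borel_measurable lborel"
    and ae: "AE x in lborel. Re (?r x) = a x" "AE x in lborel. Im (?r x) = b x"
    by blast
  define r' where "r' = (\<lambda>x. indicator {0<..<T} x *\<^sub>R Complex (a x) (b x))"
  have r'_alt: "r' = (\<lambda>x. indicator {0<..<T} x *\<^sub>R (complex_of_real (a x) + \<i> * complex_of_real (b x)))"
    by (simp add: r'_def complex_eq_iff fun_eq_iff)
  have meas: "r' \<in> borel_measurable borel"
    unfolding r'_alt by measurable
  have eq: "AE x in lborel. ?r x = r' x"
    using ae by eventually_elim (auto simp: r'_def complex_eq_iff split: split_indicator_asm split_indicator)
  have "integrable lebesgue r'"
    using int meas eq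
    by (subst integrable_cong_AE[where g = ?r])
       (auto intro!: measurable_completion AE_completion elim: eventually_mono borel_measurable_integrable)
  then have "integrable lborel r'"
    using meas by (simp add: integrable_completion)
  moreover have "AE x in lborel. x \<in> {0<..<T} \<longrightarrow> r x = r' x"
    using eq by eventually_elim (auto simp: r'_def)
  ultimately show ?thesis using that by (simp add: r'_def)
qed

lemma exponential_weight_makes_integral_small:
  fixes g :: "real \<Rightarrow> real"
  assumes g: "integrable lborel g" and nonneg: "\<And>x. 0 \<le> g x" and supp: "\<And>x. x \<le> 0 \<Longrightarrow> g x = 0"
    and eps: "0 < \<epsilon>"
  obtains \<beta> where "0 \<le> \<beta>" "integrable lborel (\<lambda>x. g x * exp (- \<beta> * x))"
    "(LINT x|lborel. g x * exp (- \<beta> * x)) < \<epsilon>"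
proof -
  have [measurable]: "g \<in> borel_measurable borel" using borel_measurable_integrable[OF g] by simp
  let ?s = "\<lambda>n x. g x * exp (- real n * x)"
  have bd: "norm (?s n x) \<le> g x" for n x
  proof (cases "x \<le> 0")
    case False
    then have "g x * exp (- real n * x) \<le> g x * 1" by (intro mult_left_mono nonneg) auto
    then show ?thesis by (simp add: abs_mult nonneg)
  qed (simp add: supp)
  have lim: "(\<lambda>n. ?s n x) \<longlonglongrightarrow> 0" for x
  proof (cases "x \<le> 0")
    case False
    have "(\<lambda>n. exp (- x) ^ n) \<longlonglongrightarrow> 0" by (rule LIMSEQ_realpow_zero) (use False in auto)
    then have "(\<lambda>n. g x * exp (- x) ^ n) \<longlonglongrightarrow> 0" by (rule tendsto_mult_right_zero)
    then show ?thesis by (simp add: exp_of_nat_mult[symmetric])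
  qed (simp add: supp)
  have "(\<lambda>n. LINT x|lborel. ?s n x) \<longlonglongrightarrow> (LINT x::real|lborel. (0::real))"
    by (rule integral_dominated_convergence[where w = g]) (use g lim bd in auto)
  then have "\<forall>\<^sub>F n in sequentially. (LINT x|lborel. ?s n x) < \<epsilon>"
    using eps by (intro order_tendstoD) auto
  then obtain n where "(LINT x|lborel. ?s n x) < \<epsilon>"
    by (auto simp: eventually_sequentially)
  moreover have "integrable lborel (?s n)"
    by (rule Bochner_Integration.integrable_bound[OF g]) (use bd in \<open>auto simp: nonneg\<close>)
  ultimately show ?thesis using that[of "real n"] by simp
qed

text \<open>
  The exponential weight produces the smallness. With
  \<open>\<phi>(t) = e\<^sup>\<beta>\<^sup>t\<close> the contraction constant is \<open>\<integral> g(x) e\<^sup>-\<^sup>\<beta>\<^sup>x dx\<close>, and the integrable majorant \<open>g\<close>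
  lives on \<open>x > 0\<close>, so the constant falls below any bound when \<open>\<beta>\<close> grows. The singularity of \<open>g\<close>
  at 0 is harmless.
\<close>

lemma convolution_majorant_imp_contraction:
  fixes G :: "real \<Rightarrow> real \<Rightarrow> complex"
  assumes [measurable]: "case_prod G \<in> borel_measurable (borel \<Otimes>\<^sub>M borel)"
    and g: "integrable lborel g" and supp: "\<And>x. x \<le> 0 \<Longrightarrow> g x = 0"
    and le: "\<And>t s. norm (G t s) \<le> g (t - s)"
  obtains \<beta> where "0 \<le> \<beta>" "weighted_contraction_kernel G (\<lambda>t. exp (\<beta> * t)) (1 / 2)"
proof -
  have nonneg: "0 \<le> g x" for x using order_trans[OF norm_ge_zero le[of x 0]] by simp
  obtain \<beta> where \<beta>: "0 \<le> \<beta>" "integrable lborel (\<lambda>x. g x * exp (- \<beta> * x))"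
    "(LINT x|lborel. g x * exp (- \<beta> * x)) < 1 / 2"
    by (rule exponential_weight_makes_integral_small[OF g nonneg supp, where \<epsilon> = "1 / 2"]) auto
  have [measurable]: "g \<in> borel_measurable borel" using borel_measurable_integrable[OF g] by simp
  have "(\<integral>\<^sup>+s. ennreal (norm (G t s) * exp (\<beta> * s)) \<partial>lborel) \<le> ennreal (1 / 2 * exp (\<beta> * t))" for t
  proof -
    have "(\<integral>\<^sup>+s. ennreal (norm (G t s) * exp (\<beta> * s)) \<partial>lborel)
        \<le> (\<integral>\<^sup>+s. ennreal (exp (\<beta> * t)) * ennreal (g (t - s) * exp (- \<beta> * (t - s))) \<partial>lborel)"
    proof (rule nn_integral_mono)
      fix s
      have "norm (G t s) * exp (\<beta> * s) \<le> g (t - s) * (exp (\<beta> * t) * exp (- \<beta> * (t - s)))"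
        unfolding mult_exp_exp using le by (intro mult_mono) (auto simp: algebra_simps nonneg)
      then show "ennreal (norm (G t s) * exp (\<beta> * s))
          \<le> ennreal (exp (\<beta> * t)) * ennreal (g (t - s) * exp (- \<beta> * (t - s)))"
        by (simp add: ennreal_mult[symmetric] nonneg ennreal_leI mult_ac)
    qed
    also have "\<dots> = ennreal (exp (\<beta> * t)) * (\<integral>\<^sup>+s. ennreal (g (t - s) * exp (- \<beta> * (t - s))) \<partial>lborel)"
      by (rule nn_integral_cmult) measurable
    also have "(\<integral>\<^sup>+s. ennreal (g (t - s) * exp (- \<beta> * (t - s))) \<partial>lborel)
        = (\<integral>\<^sup>+x. ennreal (g x * exp (- \<beta> * x)) \<partial>lborel)"
      using nn_integral_real_affine[of "\<lambda>x. ennreal (g x * exp (- \<beta> * x))" "-1" t] by simp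
    also have "\<dots> = ennreal (LINT x|lborel. g x * exp (- \<beta> * x))"
      by (rule nn_integral_eq_integral[OF \<beta>(2)]) (simp add: nonneg)
    also have "ennreal (exp (\<beta> * t)) * \<dots> \<le> ennreal (exp (\<beta> * t)) * ennreal (1 / 2)"
      using \<beta>(3) by (intro mult_left_mono ennreal_leI) auto
    also have "\<dots> = ennreal (1 / 2 * exp (\<beta> * t))"
      by (subst ennreal_mult[symmetric]) (auto simp: mult.commute)
    finally show ?thesis .
  qed
  then have "weighted_contraction_kernel G (\<lambda>t. exp (\<beta> * t)) (1 / 2)"
    by unfold_locales auto
  then show ?thesis using that \<beta>(1) by blast
qed

section \<open>Volterra operators on continuous functions\<close>

lemma cont_space_zero: "f \<in> cont_space T \<Longrightarrow> t \<notin> {0..T} \<Longrightarrow> f t = 0"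
  by (auto simp: cont_space_def)

lemma cont_space_measurable:
  assumes "f \<in> cont_space T"
  shows "f \<in> borel_measurable borel"
proof -
  have "(\<lambda>x. indicator {0..T} x *\<^sub>R f x) \<in> borel_measurable borel"
    using assms by (intro borel_measurable_continuous_on_indicator) (auto simp: cont_space_def)
  moreover have "(\<lambda>x. indicator {0..T} x *\<^sub>R f x) = f"
    using assms by (auto simp: cont_space_def indicator_def fun_eq_iff)
  ultimately show ?thesis by simp
qed

lemma cont_space_bounded:
  assumes "f \<in> cont_space T"
  obtains M where "0 \<le> M" "\<And>t. norm (f t) \<le> M"
proof -
  have "bounded (f ` {0..T})"
    using assms by (intro compact_imp_bounded compact_continuous_image) (auto simp: cont_space_def)
  then obtain M where "0 < M" "\<And>t. t \<in> {0..T} \<Longrightarrow> norm (f t) \<le> M"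
    by (auto simp: bounded_pos)
  then have "norm (f t) \<le> M" for t
    using cont_space_zero[OF assms, of t] by (cases "t \<in> {0..T}") auto
  with \<open>0 < M\<close> show ?thesis using that[of M] by simp
qed

lemma cont_space_integrable:
  assumes "f \<in> cont_space T"
  shows "integrable lborel f"
proof -
  obtain M where "\<And>t. norm (f t) \<le> M" using cont_space_bounded[OF assms] by blast
  then show ?thesis
    using cont_space_zero[OF assms] cont_space_measurable[OF assms]
    by (intro integrableI_bounded_set[where A = "{0..T}" and B = M]) (auto simp: emeasure_lborel_Icc_eq)
qed

lemma volterra_op_eq_kernel_op:
  assumes "t \<in> {0..T}" and [measurable]: "G' t \<in> borel_measurable borel" "f \<in> borel_measurable borel"
    and "AE s in lborel. s \<in> {0..t} \<longrightarrow> G t s = G' t s"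
    and "\<And>s. s \<notin> {0..t} \<Longrightarrow> G' t s * f s = 0"
  shows "volterra_op T G f t = kernel_op G' f t"
proof -
  have "(LINT s:{0..t}|lebesgue. G t s * f s) = (LINT s|lborel. G' t s * f s)"
    using assms(4) by (intro set_integral_lebesgue_eq_lborel assms(5)) (auto elim: eventually_mono)
  then show ?thesis using assms(1) by (simp add: volterra_op_def kernel_op_def)
qed

lemma conv_op_eq_kernel_op:
  assumes q': "integrable lborel q'" "\<And>x. x \<notin> {0<..<T} \<Longrightarrow> q' x = 0"
    and eq: "AE x in lborel. x \<in> {0<..<T} \<longrightarrow> q x = q' x"
    and f: "f \<in> cont_space T" and t: "t \<in> {0..T}"
  shows "conv_op T q f t = kernel_op (\<lambda>t s. q' (t - s)) f t"
  unfolding conv_op_def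
proof (rule volterra_op_eq_kernel_op[OF t])
  have [measurable]: "q' \<in> borel_measurable borel" using borel_measurable_integrable[OF q'(1)] by simp
  show "(\<lambda>s. q' (t - s)) \<in> borel_measurable borel" by measurable
  show "f \<in> borel_measurable borel" by (rule cont_space_measurable[OF f])
  show "AE s in lborel. s \<in> {0..t} \<longrightarrow> q (t - s) = q' (t - s)"
    using AE_lborel_reflect[OF eq, of t] AE_lborel_singleton[of t] AE_lborel_singleton[of "t - T"]
    by eventually_elim (use t in auto)
  show "q' (t - s) * f s = 0" if "s \<notin> {0..t}" for s
    using that cont_space_zero[OF f, of s] q'(2)[of "t - s"] by (cases "s < 0") auto
qed

text \<open>
  After the reflection \<open>x = t - s\<close> only \<open>f(t - x)\<close> depends on \<open>t\<close>. The extension of \<open>f\<close> by zero is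
  continuous except possibly at \<open>0\<close> and \<open>T\<close>, hence dominated convergence applies with the majorant
  \<open>\<bar>q\<bar> sup \<bar>f\<bar>\<close>.
\<close>

lemma continuous_convolution:
  fixes q f :: "real \<Rightarrow> complex"
  assumes q: "integrable lborel q" and f: "f \<in> cont_space T"
  shows "continuous_on UNIV (kernel_op (\<lambda>t s. q (t - s)) f)"
proof -
  have [measurable]: "q \<in> borel_measurable borel" using borel_measurable_integrable[OF q] by simp
  note [measurable] = cont_space_measurable[OF f]
  obtain M where M: "0 \<le> M" "\<And>t. norm (f t) \<le> M" using cont_space_bounded[OF f] by blast
  have flip: "kernel_op (\<lambda>t s. q (t - s)) f t = (LINT x|lborel. q x * f (t - x))" for t
    unfolding kernel_op_def
    using lborel_integral_real_affine[of "-1" "\<lambda>s. q (t - s) * f s" t] by simp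
  have cont_f: "isCont f x" if "x \<noteq> 0" "x \<noteq> T" for x
  proof (cases "x \<in> {0<..<T}")
    case True
    have "continuous_on {0<..<T} f"
      using f by (auto simp: cont_space_def intro: continuous_on_subset)
    with True show ?thesis by (simp add: continuous_on_eq_continuous_at)
  next
    case False
    have "open (- {0..T})" by auto
    moreover have "continuous_on (- {0..T}) f"
      by (rule continuous_on_eq[of _ "\<lambda>_. 0"]) (use cont_space_zero[OF f] in auto)
    moreover have "x \<in> - {0..T}" using False that by auto
    ultimately show ?thesis by (simp only: continuous_on_eq_continuous_at)
  qed
  have "(\<lambda>n. LINT x|lborel. q x * f (u n - x)) \<longlonglongrightarrow> (LINT x|lborel. q x * f (t - x))"
    if u: "u \<longlonglongrightarrow> t" for u t
  proof (rule integral_dominated_convergence[where w = "\<lambda>x. M * norm (q x)"])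
    show "integrable lborel (\<lambda>x. M * norm (q x))" using q by simp
    show "AE x in lborel. (\<lambda>n. q x * f (u n - x)) \<longlonglongrightarrow> q x * f (t - x)"
      using AE_lborel_singleton[of t] AE_lborel_singleton[of "t - T"]
    proof eventually_elim
      case (elim x)
      then have "isCont f (t - x)" by (intro cont_f) auto
      then have "(\<lambda>n. f (u n - x)) \<longlonglongrightarrow> f (t - x)"
        by (rule isCont_tendsto_compose) (intro tendsto_intros u)
      then show ?case by (intro tendsto_intros)
    qed
    show "AE x in lborel. norm (q x * f (u n - x)) \<le> M * norm (q x)" for n
      using M by (auto simp: norm_mult mult.commute[of M] intro!: mult_left_mono)
  qed measurable
  then show ?thesis
    unfolding continuous_on_sequentially by (auto simp: flip o_def)
qed

definition triangle_extension :: "real \<Rightarrow> (real \<Rightarrow> real \<Rightarrow> complex) \<Rightarrow> real \<Rightarrow> real \<Rightarrow> complex" where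
  "triangle_extension T K t s = (if 0 \<le> s \<and> s \<le> t \<and> t \<le> T then K t s else 0)"

lemma compact_closed_triangle: "compact (closed_triangle T)"
proof -
  have "closed_triangle T = ({z. 0 \<le> snd z} \<inter> {z. snd z \<le> fst z} \<inter> {z. fst z \<le> T})"
    by (auto simp: closed_triangle_def)
  moreover have "closed \<dots>"
    by (intro closed_Int closed_Collect_le continuous_intros)
  moreover have "bounded (closed_triangle T)"
    by (rule bounded_subset[of "{0..T} \<times> {0..T}"]) (auto simp: closed_triangle_def intro: bounded_Times)
  ultimately show ?thesis by (simp add: compact_eq_bounded_closed)
qed

lemma triangle_extension_measurable:
  assumes "continuous_on (closed_triangle T) (\<lambda>(t, s). K t s)"
  shows "case_prod (triangle_extension T K) \<in> borel_measurable (borel \<Otimes>\<^sub>M borel)"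
proof -
  have "closed_triangle T \<in> sets borel"
    by (intro borel_compact compact_closed_triangle)
  then have "(\<lambda>z. indicator (closed_triangle T) z *\<^sub>R (\<lambda>(t, s). K t s) z) \<in> borel_measurable borel"
    using assms by (rule borel_measurable_continuous_on_indicator)
  moreover have "(\<lambda>z. indicator (closed_triangle T) z *\<^sub>R (\<lambda>(t, s). K t s) z) = case_prod (triangle_extension T K)"
    by (auto simp: triangle_extension_def closed_triangle_def fun_eq_iff indicator_def)
  ultimately show ?thesis by (simp add: borel_prod)
qed

lemma triangle_extension_bounded:
  assumes "continuous_on (closed_triangle T) (\<lambda>(t, s). K t s)"
  obtains M where "0 \<le> M" "\<And>t s. norm (triangle_extension T K t s) \<le> M"
proof -
  have "bounded ((\<lambda>(t, s). K t s) ` closed_triangle T)"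
    using assms by (intro compact_imp_bounded compact_continuous_image compact_closed_triangle)
  then obtain M where M: "0 < M" "\<forall>z\<in>closed_triangle T. norm (case z of (t, s) \<Rightarrow> K t s) \<le> M"
    unfolding bounded_pos by auto
  have "norm (triangle_extension T K t s) \<le> M" for t s
    using bspec[OF M(2), of "(t, s)"] M(1) by (auto simp: triangle_extension_def closed_triangle_def)
  with M(1) show ?thesis using that[of M] by simp
qed

text \<open>
  For fixed \<open>s\<close> the extended kernel is continuous in \<open>t\<close> except when crossing the diagonal \<open>t = s\<close>,
  which costs one point of the domain of integration, so dominated convergence applies.
\<close>

lemma continuous_volterra:
  fixes f :: "real \<Rightarrow> complex"
  assumes K: "continuous_on (closed_triangle T) (\<lambda>(t, s). K t s)" and f: "f \<in> cont_space T"
  shows "continuous_on {0..T} (kernel_op (triangle_extension T K) f)"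
proof -
  note [measurable] = cont_space_measurable[OF f] triangle_extension_measurable[OF K]
  obtain M where M: "0 \<le> M" "\<And>t s. norm (triangle_extension T K t s) \<le> M"
    using triangle_extension_bounded[OF K] by blast
  have "(\<lambda>n. LINT s|lborel. triangle_extension T K (u n) s * f s)
      \<longlonglongrightarrow> (LINT s|lborel. triangle_extension T K t s * f s)"
    if u: "u \<longlonglongrightarrow> t" "\<And>n. u n \<in> {0..T}" and t: "t \<in> {0..T}" for u t
  proof (rule integral_dominated_convergence[where w = "\<lambda>s. M * norm (f s)"])
    show "integrable lborel (\<lambda>x. M * norm (f x))" using cont_space_integrable[OF f] by simp
    show "AE s in lborel. (\<lambda>n. triangle_extension T K (u n) s * f s) \<longlonglongrightarrow> triangle_extension T K t s * f s"
      using AE_lborel_singleton[of t]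
    proof eventually_elim
      case (elim s)
      consider "s < 0" | "t < s" | "0 \<le> s" "s < t" using elim by linarith
      then show ?case
      proof cases
        case 1
        then show ?thesis by (simp add: triangle_extension_def)
      next
        case 2
        have "\<forall>\<^sub>F n in sequentially. u n < s" using u(1) 2 by (rule order_tendstoD)
        then have "\<forall>\<^sub>F n in sequentially. triangle_extension T K (u n) s * f s = 0"
          by eventually_elim (auto simp: triangle_extension_def)
        then have "(\<lambda>n. triangle_extension T K (u n) s * f s) \<longlonglongrightarrow> 0" by (rule tendsto_eventually)
        then show ?thesis using 2 by (simp add: triangle_extension_def)
      next
        case 3
        have "\<forall>\<^sub>F n in sequentially. s < u n" using u(1) 3(2) by (rule order_tendstoD)
        then have ev: "\<forall>\<^sub>F n in sequentially. (u n, s) \<in> closed_triangle T"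
          by eventually_elim (use u(2) 3 in \<open>auto simp: closed_triangle_def\<close>)
        have "((\<lambda>n. (\<lambda>(t, s). K t s) (u n, s)) \<longlongrightarrow> (\<lambda>(t, s). K t s) (t, s)) sequentially"
          by (rule continuous_on_tendsto_compose[OF K]) (use u t 3 ev in \<open>auto simp: closed_triangle_def intro!: tendsto_intros\<close>)
        then have "(\<lambda>n. K (u n) s * f s) \<longlonglongrightarrow> K t s * f s" by (intro tendsto_intros) simp
        moreover have "\<forall>\<^sub>F n in sequentially. K (u n) s * f s = triangle_extension T K (u n) s * f s"
          using ev by eventually_elim (auto simp: triangle_extension_def closed_triangle_def)
        ultimately have "(\<lambda>n. triangle_extension T K (u n) s * f s) \<longlonglongrightarrow> K t s * f s"
          by (rule Lim_transform_eventually)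
        then show ?thesis using 3 t by (simp add: triangle_extension_def)
      qed
    qed
    show "AE s in lborel. norm (triangle_extension T K (u n) s * f s) \<le> M * norm (f s)" for n
      using M by (auto simp: norm_mult intro!: mult_right_mono)
  qed measurable
  then show ?thesis
    unfolding continuous_on_sequentially kernel_op_def by (auto simp: o_def)
qed

section \<open>Resolvent kernels of Volterra kernels\<close>

lemma kernel_power_causal:
  assumes "\<And>t s. \<not> s < t \<Longrightarrow> G t s = 0" "\<not> s < t"
  shows "kernel_power G n t s = 0"
  using assms(2)
proof (induction n arbitrary: t)
  case (Suc n)
  have "G t \<xi> * kernel_power G n \<xi> s = 0" for \<xi>
    using assms(1)[of \<xi> t] Suc.IH[of \<xi>] Suc.prems by (cases "\<xi> < t") auto
  then show ?case by (simp only: kernel_power.simps) simp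
qed (simp add: assms(1))

lemma kernel_power_zero_row:
  assumes "\<And>s. G t s = 0"
  shows "kernel_power G n t s = 0"
  using assms by (cases n) simp_all

text \<open>
  A convolution kernel is only determined almost everywhere, so \<open>G\<close> and \<open>G'\<close> may differ on null
  sets of rows and columns. The integral defining \<open>G\<^sub>n\<^sub>+\<^sub>1(t,s)\<close> uses row \<open>t\<close> of \<open>G\<close> and column \<open>s\<close>
  of \<open>G\<^sub>n\<close>, so agreement almost everywhere in both directions gives agreement at every point of the
  triangle from the second kernel on.
\<close>

lemma iter_kernel_eq_kernel_power:
  fixes G G' :: "real \<Rightarrow> real \<Rightarrow> complex"
  assumes meas: "case_prod G' \<in> borel_measurable (borel \<Otimes>\<^sub>M borel)"
    and causal: "\<And>t s. \<not> s < t \<Longrightarrow> G' t s = 0"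
    and rows: "\<And>t. t \<in> {0..T} \<Longrightarrow> AE s in lborel. s \<in> {0..t} \<longrightarrow> G t s = G' t s"
    and columns: "\<And>s. s \<in> {0..T} \<Longrightarrow> AE t in lborel. t \<in> {s..T} \<longrightarrow> G t s = G' t s"
    and t: "t \<in> {0..T}"
  shows "AE s in lborel. s \<in> {0..t} \<longrightarrow> iter_kernel G n t s = kernel_power G' n t s"
proof -
  note [measurable] = meas kernel_power_measurable[OF meas]
  have step: "iter_kernel G (Suc n) t s = kernel_power G' (Suc n) t s"
    if col: "AE \<xi> in lborel. \<xi> \<in> {s..T} \<longrightarrow> iter_kernel G n \<xi> s = kernel_power G' n \<xi> s"
      and st: "0 \<le> s" "s \<le> t" "t \<le> T" for n t s
    unfolding iter_kernel.simps kernel_power.simps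
  proof (rule set_integral_lebesgue_eq_lborel)
    have "AE \<xi> in lborel. \<xi> \<in> {0..t} \<longrightarrow> G t \<xi> = G' t \<xi>"
      using st by (intro rows) auto
    then show "AE \<xi> in lborel. \<xi> \<in> {s..t} \<longrightarrow>
        G t \<xi> * iter_kernel G n \<xi> s = G' t \<xi> * kernel_power G' n \<xi> s"
      using col by eventually_elim (use st in auto)
    show "G' t \<xi> * kernel_power G' n \<xi> s = 0" if "\<xi> \<notin> {s..t}" for \<xi>
      using that causal[of \<xi> t] kernel_power_causal[of G' s \<xi> n] causal by (cases "\<xi> < s") auto
  qed measurable
  have cols: "AE t in lborel. t \<in> {s..T} \<longrightarrow> iter_kernel G n t s = kernel_power G' n t s"
    if "s \<in> {0..T}" for s n
  proof (induction n)
    case 0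
    show ?case using columns[OF that] by simp
  next
    case (Suc n)
    show ?case using step[OF Suc] that by (intro AE_I2) auto
  qed
  show "AE s in lborel. s \<in> {0..t} \<longrightarrow> iter_kernel G n t s = kernel_power G' n t s"
  proof (cases n)
    case 0
    then show ?thesis using rows[OF t] by simp
  next
    case (Suc m)
    then show ?thesis using step[OF cols] t by (intro AE_I2) auto
  qed
qed

lemma volterra_op_outside: "t \<notin> {0..T} \<Longrightarrow> volterra_op T G f t = 0"
  unfolding volterra_op_def by (rule if_not_P)

lemma cont_spaceI:
  "continuous_on {0..T} f \<Longrightarrow> (\<And>t. t \<notin> {0..T} \<Longrightarrow> f t = 0) \<Longrightarrow> f \<in> cont_space T"
  by (simp add: cont_space_def)

text \<open>
  A kernel \<open>G\<close> on the triangle together with a Borel kernel \<open>G'\<close> on the plane that vanishes off the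
  strict triangle, agrees with \<open>G\<close> almost everywhere in each row and column of the triangle, and is a
  contraction for an exponential weight. Two-sided agreement is what the iterated kernels require.
\<close>

locale modelled_volterra_kernel =
  fixes T :: real and G G' :: "real \<Rightarrow> real \<Rightarrow> complex" and \<beta> :: real
  assumes model_meas [measurable]: "case_prod G' \<in> borel_measurable (borel \<Otimes>\<^sub>M borel)"
    and model_supp: "\<And>t s. \<not> (0 \<le> s \<and> s < t \<and> t \<le> T) \<Longrightarrow> G' t s = 0"
    and rows: "\<And>t. t \<in> {0..T} \<Longrightarrow> AE s in lborel. s \<in> {0..t} \<longrightarrow> G t s = G' t s"
    and columns: "\<And>s. s \<in> {0..T} \<Longrightarrow> AE t in lborel. t \<in> {s..T} \<longrightarrow> G t s = G' t s"
    and beta: "0 \<le> \<beta>"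
    and contr: "weighted_contraction_kernel G' (\<lambda>t. exp (\<beta> * t)) (1 / 2)"
    and preserves: "volterra_op T G ` cont_space T \<subseteq> cont_space T"
begin

sublocale weighted_contraction_kernel G' "\<lambda>t. exp (\<beta> * t)" "1 / 2"
  by (rule contr)

lemma weight_bounded_cont_space:
  assumes "f \<in> cont_space T"
  shows "weight_bounded f"
proof -
  obtain M where M: "0 \<le> M" "\<And>t. norm (f t) \<le> M" using cont_space_bounded[OF assms] by blast
  have "norm (f s) \<le> M * exp (\<beta> * s)" for s
  proof (cases "0 \<le> s")
    case True
    then have "M * 1 \<le> M * exp (\<beta> * s)" using M(1) beta by (intro mult_left_mono) auto
    then show ?thesis using M(2)[of s] by linarith
  qed (use M(1) cont_space_zero[OF assms, of s] in auto)
  then show ?thesis unfolding weight_bounded_def using cont_space_measurable[OF assms] by blast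
qed

lemma volterra_op_eq: "f \<in> cont_space T \<Longrightarrow> volterra_op T G f = kernel_op G' f"
proof
  fix t assume f: "f \<in> cont_space T"
  show "volterra_op T G f t = kernel_op G' f t"
  proof (cases "t \<in> {0..T}")
    case True
    then show ?thesis
      using model_supp cont_space_measurable[OF f] rows[OF True]
      by (intro volterra_op_eq_kernel_op) auto
  next
    case False
    then have "G' t s = 0" for s by (intro model_supp) auto
    then show ?thesis unfolding kernel_op_def using False by (simp add: volterra_op_outside)
  qed
qed

lemma kernel_op_cont_space: "f \<in> cont_space T \<Longrightarrow> kernel_op G' f \<in> cont_space T"
  using preserves volterra_op_eq by force

lemma resolvent_op_eq:
  assumes f: "f \<in> cont_space T"
  shows "volterra_op T (resolvent_kernel G) f = kernel_op (neumann_kernel G') f"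
proof
  fix t
  have causal: "G' t s = 0" if "\<not> s < t" for t s using that by (intro model_supp) auto
  note [measurable] = cont_space_measurable[OF f]
  show "volterra_op T (resolvent_kernel G) f t = kernel_op (neumann_kernel G') f t"
  proof (cases "t \<in> {0..T}")
    case True
    have "AE s in lborel. \<forall>n. s \<in> {0..t} \<longrightarrow> iter_kernel G n t s = kernel_power G' n t s"
      unfolding AE_all_countable
      using iter_kernel_eq_kernel_power[OF model_meas causal rows columns True] by blast
    then have "AE s in lborel. s \<in> {0..t} \<longrightarrow> resolvent_kernel G t s = neumann_kernel G' t s"
      by eventually_elim (auto simp: resolvent_kernel_def neumann_kernel_def)
    moreover have "neumann_kernel G' t s * f s = 0" if "s \<notin> {0..t}" for s
      using that cont_space_zero[OF f, of s] kernel_power_causal[of G' s t, OF causal]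
      by (cases "s < 0") (auto simp: neumann_kernel_def)
    moreover have "neumann_kernel G' t \<in> borel_measurable borel"
      unfolding neumann_kernel_def[abs_def] by measurable
    ultimately show ?thesis
      using True by (intro volterra_op_eq_kernel_op) auto
  next
    case False
    then have "G' t s = 0" for s by (intro model_supp) auto
    then have "neumann_kernel G' t s = 0" for s
      using kernel_power_zero_row[of G' t] by (simp add: neumann_kernel_def)
    then show ?thesis unfolding kernel_op_def using False by (simp add: volterra_op_outside)
  qed
qed

lemma kernel_power_op_cont_space:
  assumes f: "f \<in> cont_space T"
  shows "kernel_op (kernel_power G' n) f \<in> cont_space T"
proof (induction n)
  case 0
  show ?case using kernel_op_cont_space[OF f] by simp
next
  case (Suc n)
  have "kernel_op (kernel_power G' (Suc n)) f = kernel_op G' (kernel_op (kernel_power G' n) f)"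
    using kernel_op_power_Suc[OF weight_bounded_cont_space[OF f]] by blast
  then show ?case using kernel_op_cont_space[OF Suc] by simp
qed

lemma resolvent_op_cont_space:
  assumes f: "f \<in> cont_space T"
  shows "volterra_op T (resolvent_kernel G) f \<in> cont_space T"
proof (rule cont_spaceI)
  show "continuous_on {0..T} (volterra_op T (resolvent_kernel G) f)"
    unfolding resolvent_op_eq[OF f]
  proof (rule continuous_on_neumann[OF weight_bounded_cont_space[OF f]])
    show "continuous_on {0..T} (kernel_op (kernel_power G' n) f)" for n
      using kernel_power_op_cont_space[OF f] by (simp add: cont_space_def)
    show "exp (\<beta> * t) \<le> exp (\<beta> * T)" if "t \<in> {0..T}" for t
      using that beta by (auto intro!: mult_left_mono)
  qed
qed (rule volterra_op_outside)

lemma second_kind_solution_exists: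
  assumes f: "f \<in> cont_space T"
  obtains g where "g \<in> cont_space T" "(\<lambda>t. g t + volterra_op T G g t) = f"
proof
  let ?S = "volterra_op T (resolvent_kernel G) f"
  let ?g = "\<lambda>t. f t - ?S t"
  show g: "?g \<in> cont_space T"
    using f resolvent_op_cont_space[OF f] by (auto simp: cont_space_def intro!: continuous_on_diff)
  show "(\<lambda>t. ?g t + volterra_op T G ?g t) = f"
    unfolding volterra_op_eq[OF g] using neumann_inverse_exists[OF weight_bounded_cont_space[OF f]]
    by (simp add: resolvent_op_eq[OF f])
qed

lemma second_kind_solution_unique:
  assumes g: "g \<in> cont_space T" and f: "f \<in> cont_space T"
    and eq: "(\<lambda>t. g t + volterra_op T G g t) = f"
  shows "g = (\<lambda>t. f t - volterra_op T (resolvent_kernel G) f t)"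
proof -
  have "f = (\<lambda>t. g t + kernel_op G' g t)" using eq volterra_op_eq[OF g] by simp
  moreover from this have "kernel_op (neumann_kernel G') f t = kernel_op G' g t" for t
    using neumann_inverse_unique[OF weight_bounded_cont_space[OF g], of t] by simp
  ultimately show ?thesis unfolding resolvent_op_eq[OF f] by auto
qed

end

section \<open>Power-bounded kernels\<close>

lemma power_bounded_iff_lborel:
  "power_bounded T q \<longleftrightarrow>
    (\<exists>C>0. \<exists>\<eta>>0. AE t in lborel. 0 < t \<and> t < T \<longrightarrow> norm (q t) \<le> C * t powr (\<eta> - 1))"
  by (simp add: power_bounded_def AE_completion_iff)

text \<open>
  On \<open>(0,T)\<close> a larger exponent is dominated by a smaller one up to the factor
  \<open>T\<^sup>\<nu>\<^sup>-\<^sup>\<mu>\<close>, so the smaller of the two exponents serves for the sum.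
\<close>

lemma power_bounded_add:
  assumes "power_bounded T a" "power_bounded T b"
  shows "power_bounded T (\<lambda>x. a x + b x)"
proof (cases "0 < T")
  case True
  from assms obtain C \<eta> D \<theta> where pos: "0 < C" "0 < \<eta>" "0 < D" "0 < \<theta>"
    and ae: "AE t in lborel. 0 < t \<and> t < T \<longrightarrow> norm (a t) \<le> C * t powr (\<eta> - 1)"
      "AE t in lborel. 0 < t \<and> t < T \<longrightarrow> norm (b t) \<le> D * t powr (\<theta> - 1)"
    unfolding power_bounded_iff_lborel by blast
  define \<mu> where "\<mu> = min \<eta> \<theta>"
  have mono: "t powr (\<nu> - 1) \<le> T powr (\<nu> - \<mu>) * t powr (\<mu> - 1)"
    if "0 < t" "t < T" "\<mu> \<le> \<nu>" for t \<nu>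
  proof -
    have "t powr (\<nu> - 1) = t powr (\<nu> - \<mu>) * t powr (\<mu> - 1)"
      by (simp add: powr_add[symmetric])
    also have "\<dots> \<le> T powr (\<nu> - \<mu>) * t powr (\<mu> - 1)"
      using that by (intro mult_right_mono powr_mono2) auto
    finally show ?thesis .
  qed
  let ?E = "C * T powr (\<eta> - \<mu>) + D * T powr (\<theta> - \<mu>)"
  have "AE t in lborel. 0 < t \<and> t < T \<longrightarrow> norm (a t + b t) \<le> ?E * t powr (\<mu> - 1)"
    using ae
  proof eventually_elim
    case (elim t)
    show ?case
    proof
      assume t: "0 < t \<and> t < T"
      have "norm (a t + b t) \<le> C * t powr (\<eta> - 1) + D * t powr (\<theta> - 1)"
        using elim t by (intro norm_triangle_mono) auto
      also have "\<dots> \<le> C * (T powr (\<eta> - \<mu>) * t powr (\<mu> - 1)) + D * (T powr (\<theta> - \<mu>) * t powr (\<mu> - 1))"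
        using t pos by (intro add_mono mult_left_mono mono) (auto simp: \<mu>_def)
      finally show "norm (a t + b t) \<le> ?E * t powr (\<mu> - 1)"
        by (simp add: algebra_simps)
    qed
  qed
  moreover have "0 < ?E" "0 < \<mu>" using pos True by (auto simp: \<mu>_def intro!: add_pos_pos)
  ultimately show ?thesis unfolding power_bounded_iff_lborel by blast
next
  case False
  then have "\<not> (0 < t \<and> t < T)" for t by linarith
  then show ?thesis
    unfolding power_bounded_def by (auto intro!: exI[of _ 1])
qed

lemma power_bounded_const: "power_bounded T (\<lambda>_. c)"
  unfolding power_bounded_def
  by (rule exI[of _ "norm c + 1"]) (auto intro!: exI[of _ 1] simp: add_nonneg_pos)

lemma power_bounded_mult_norm:
  assumes "power_bounded T a" "0 \<le> M"
  shows "power_bounded T (\<lambda>x. of_real (M * norm (a x)))"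
proof -
  from assms obtain C \<eta> where "0 < C" "0 < \<eta>"
    and ae: "AE t in lborel. 0 < t \<and> t < T \<longrightarrow> norm (a t) \<le> C * t powr (\<eta> - 1)"
    unfolding power_bounded_iff_lborel by blast
  \<comment> \<open>The summand \<open>C\<close> keeps the constant positive when \<open>M = 0\<close>.\<close>
  have "AE t in lborel. 0 < t \<and> t < T \<longrightarrow> norm (complex_of_real (M * norm (a t))) \<le> (M * C + C) * t powr (\<eta> - 1)"
    using ae
  proof eventually_elim
    case (elim t)
    show ?case
    proof
      assume t: "0 < t \<and> t < T"
      have "norm (complex_of_real (M * norm (a t))) = M * norm (a t)"
        using assms(2) by (simp add: norm_mult)
      also have "\<dots> \<le> M * (C * t powr (\<eta> - 1))" using elim t assms(2) by (intro mult_left_mono) auto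
      also have "\<dots> \<le> (M * C + C) * t powr (\<eta> - 1)" using \<open>0 < C\<close> by (simp add: algebra_simps)
      finally show "norm (complex_of_real (M * norm (a t))) \<le> \<dots>" .
    qed
  qed
  moreover have "0 < M * C + C" using \<open>0 < C\<close> assms(2) by (simp add: add_nonneg_pos)
  ultimately show ?thesis unfolding power_bounded_iff_lborel using \<open>0 < \<eta>\<close> by blast
qed

lemma power_bounded_sum:
  "finite A \<Longrightarrow> (\<And>j. j \<in> A \<Longrightarrow> power_bounded T (a j)) \<Longrightarrow> power_bounded T (\<lambda>x. \<Sum>j\<in>A. a j x)"
proof (induction rule: finite_induct)
  case empty
  show ?case using power_bounded_const[of T 0] by simp
next
  case (insert j A)
  then show ?case using power_bounded_add[of T "a j" "\<lambda>x. \<Sum>j\<in>A. a j x"] by simp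
qed

lemma power_bounded_cong_AE:
  assumes "power_bounded T q" "AE x in lborel. x \<in> {0<..<T} \<longrightarrow> q x = q' x"
  shows "power_bounded T q'"
proof -
  from assms(1) obtain C \<eta> where pos: "0 < C" "0 < \<eta>"
    and ae: "AE t in lborel. 0 < t \<and> t < T \<longrightarrow> norm (q t) \<le> C * t powr (\<eta> - 1)"
    unfolding power_bounded_iff_lborel by blast
  have "AE t in lborel. 0 < t \<and> t < T \<longrightarrow> norm (q' t) \<le> C * t powr (\<eta> - 1)"
    using ae assms(2) by eventually_elim auto
  with pos show ?thesis unfolding power_bounded_iff_lborel by blast
qed

section \<open>The causal equation\<close>

text \<open>
  The coefficients of \<open>L\<close> with chosen Borel representatives \<open>r'\<close> and \<open>q'\<close> of \<open>r\<close> and \<open>q\<close>.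
\<close>

locale causal_equation_data =
  fixes T :: real and r r' :: "real \<Rightarrow> complex" and N :: nat
    and p q q' :: "nat \<Rightarrow> real \<Rightarrow> complex" and K :: "real \<Rightarrow> real \<Rightarrow> complex"
  assumes T_pos: "0 < T"
    and r'_int: "integrable lborel r'" and r'_supp: "\<And>x. x \<notin> {0<..<T} \<Longrightarrow> r' x = 0"
    and r_eq: "AE x in lborel. x \<in> {0<..<T} \<longrightarrow> r x = r' x"
    and q'_int: "\<And>j. j \<in> {1..N} \<Longrightarrow> integrable lborel (q' j)"
    and q'_supp: "\<And>j x. j \<in> {1..N} \<Longrightarrow> x \<notin> {0<..<T} \<Longrightarrow> q' j x = 0"
    and q_eq: "\<And>j. j \<in> {1..N} \<Longrightarrow> AE x in lborel. x \<in> {0<..<T} \<longrightarrow> q j x = q' j x"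
    and p_cont: "\<And>j. j \<in> {1..N} \<Longrightarrow> p j \<in> cont_space T"
    and K_cont: "continuous_on (closed_triangle T) (\<lambda>(t, s). K t s)"
begin

abbreviation "K' \<equiv> triangle_extension T K"

definition bounded_part :: "real \<Rightarrow> real \<Rightarrow> complex" where
  "bounded_part t s = (LINT \<xi>|lborel. K' t \<xi> * r' (\<xi> - s))"

text \<open>
  The Borel counterpart of \<open>G\<^sub>L\<close>. The cut-off is needed because \<open>q'(t - s)\<close> by itself does not
  vanish for \<open>s < 0\<close>.
\<close>

definition GL' :: "real \<Rightarrow> real \<Rightarrow> complex" where
  "GL' t s = (if 0 \<le> s \<and> s < t \<and> t \<le> T
     then (\<Sum>j=1..N. p j t * q' j (t - s)) + bounded_part t s else 0)"

lemma GL'_outside: "\<not> (0 \<le> s \<and> s < t \<and> t \<le> T) \<Longrightarrow> GL' t s = 0"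
  unfolding GL'_def by (rule if_not_P)

lemma r'_meas [measurable]: "r' \<in> borel_measurable borel"
  using borel_measurable_integrable[OF r'_int] by simp

lemma q'_meas [measurable]: "j \<in> {1..N} \<Longrightarrow> q' j \<in> borel_measurable borel"
  using borel_measurable_integrable[OF q'_int] by simp

lemma p_meas [measurable]: "j \<in> {1..N} \<Longrightarrow> p j \<in> borel_measurable borel"
  by (rule cont_space_measurable[OF p_cont])

lemmas K'_meas [measurable] = triangle_extension_measurable[OF K_cont]

lemma bounded_part_meas [measurable]: "case_prod bounded_part \<in> borel_measurable (borel \<Otimes>\<^sub>M borel)"
  unfolding bounded_part_def[abs_def] by measurable

lemma singular_part_meas [measurable]:
  "(\<lambda>(t, s). \<Sum>j=1..N. p j t * q' j (t - s)) \<in> borel_measurable (borel \<Otimes>\<^sub>M borel)"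
  unfolding split_beta
proof (rule borel_measurable_sum)
  fix j assume "j \<in> {1..N}"
  note [measurable] = p_meas[OF this] q'_meas[OF this]
  show "(\<lambda>z. p j (fst z) * q' j (fst z - snd z)) \<in> borel_measurable (borel \<Otimes>\<^sub>M borel)"
    by measurable
qed

lemma GL'_meas [measurable]: "case_prod GL' \<in> borel_measurable (borel \<Otimes>\<^sub>M borel)"
proof -
  have "(\<lambda>z. if 0 \<le> snd z \<and> snd z < fst z \<and> fst z \<le> T
      then (\<lambda>(t, s). \<Sum>j=1..N. p j t * q' j (t - s)) z + case_prod bounded_part z else 0)
    \<in> borel_measurable (borel \<Otimes>\<^sub>M borel)"
    by measurable
  moreover have "case_prod GL' = (\<lambda>z. if 0 \<le> snd z \<and> snd z < fst z \<and> fst z \<le> T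
      then (\<lambda>(t, s). \<Sum>j=1..N. p j t * q' j (t - s)) z + case_prod bounded_part z else 0)"
    by (auto simp: GL'_def fun_eq_iff)
  ultimately show ?thesis by simp
qed

lemma bounded_part_eq:
  assumes "0 \<le> s" "s \<le> t" "t \<le> T"
  shows "(LINT \<xi>:{s..t}|lebesgue. K t \<xi> * r (\<xi> - s)) = bounded_part t s"
  unfolding bounded_part_def
proof (rule set_integral_lebesgue_eq_lborel)
  show "AE \<xi> in lborel. \<xi> \<in> {s..t} \<longrightarrow> K t \<xi> * r (\<xi> - s) = K' t \<xi> * r' (\<xi> - s)"
    using AE_lborel_translate[OF r_eq, of s] AE_lborel_singleton[of s] AE_lborel_singleton[of "s + T"]
    by eventually_elim (use assms in \<open>auto simp: triangle_extension_def\<close>)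
  show "K' t \<xi> * r' (\<xi> - s) = 0" if "\<xi> \<notin> {s..t}" for \<xi>
    using that r'_supp[of "\<xi> - s"] by (cases "\<xi> < s") (auto simp: triangle_extension_def)
qed measurable

lemma AE_q_eq: "AE x in lborel. 0 < x \<and> x \<le> T \<longrightarrow> (\<forall>j\<in>{1..N}. q j x = q' j x)"
proof -
  have "AE x in lborel. \<forall>j\<in>{1..N}. x \<in> {0<..<T} \<longrightarrow> q j x = q' j x"
    by (intro AE_finite_allI q_eq) simp_all
  then show ?thesis
    using AE_lborel_singleton[of T] by eventually_elim auto
qed

lemma GL_eq_GL':
  assumes "0 \<le> s" "s < t" "t \<le> T" "\<forall>j\<in>{1..N}. q j (t - s) = q' j (t - s)"
  shows "kernel_GL r N p q K t s = GL' t s"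
  using assms by (simp add: kernel_GL_def GL'_def bounded_part_eq)

lemma GL_rows: "t \<in> {0..T} \<Longrightarrow> AE s in lborel. s \<in> {0..t} \<longrightarrow> kernel_GL r N p q K t s = GL' t s"
  using AE_lborel_reflect[OF AE_q_eq, of t] AE_lborel_singleton[of t]
  by eventually_elim (auto intro!: GL_eq_GL')

lemma GL_columns: "s \<in> {0..T} \<Longrightarrow> AE t in lborel. t \<in> {s..T} \<longrightarrow> kernel_GL r N p q K t s = GL' t s"
  using AE_lborel_translate[OF AE_q_eq, of s] AE_lborel_singleton[of s]
  by eventually_elim (auto intro!: GL_eq_GL')

lemma GL_triangle:
  "AE z in lborel. z \<in> strict_triangle T \<longrightarrow> case_prod (kernel_GL r N p q K) z = case_prod GL' z"
  using AE_lborel_difference[OF AE_q_eq]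
  by eventually_elim (auto simp: strict_triangle_def intro!: GL_eq_GL')

text \<open>
  Only the first term of \<open>G\<^sub>L\<close> can be singular at the diagonal: the second is at most
  \<open>sup \<bar>K\<bar>\<close> times the integral of \<open>\<bar>r\<bar>\<close>.
\<close>

lemma bounded_part_bounded:
  obtains D where "0 \<le> D" "\<And>t s. norm (bounded_part t s) \<le> D"
proof -
  obtain M where M: "0 \<le> M" "\<And>t s. norm (K' t s) \<le> M" using triangle_extension_bounded[OF K_cont] by blast
  have int: "integrable lborel (\<lambda>\<xi>. r' (\<xi> - s))" for s
    using lborel_integrable_real_affine[OF r'_int, of 1 "- s"] by simp
  have "norm (bounded_part t s) \<le> M * (LINT x|lborel. norm (r' x))" for t s
  proof -
    have le: "norm (K' t \<xi> * r' (\<xi> - s)) \<le> M * norm (r' (\<xi> - s))" for \<xi>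
      unfolding norm_mult by (intro mult_right_mono M) simp
    have int': "integrable lborel (\<lambda>\<xi>. K' t \<xi> * r' (\<xi> - s))"
    proof (rule Bochner_Integration.integrable_bound)
      show "integrable lborel (\<lambda>\<xi>. M * norm (r' (\<xi> - s)))" using int by simp
      show "AE \<xi> in lborel. norm (K' t \<xi> * r' (\<xi> - s)) \<le> norm (M * norm (r' (\<xi> - s)))"
        using le M(1) by (intro AE_I2) simp
    qed measurable
    have "norm (bounded_part t s) \<le> (LINT \<xi>|lborel. norm (K' t \<xi> * r' (\<xi> - s)))"
      unfolding bounded_part_def by (rule integral_norm_bound)
    also have "\<dots> \<le> (LINT \<xi>|lborel. M * norm (r' (\<xi> - s)))"
      using le int int' by (intro integral_mono integrable_norm integrable_mult_right) auto
    also have "\<dots> = M * (LINT x|lborel. norm (r' x))"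
      using lborel_integral_real_affine[of 1 "\<lambda>x. norm (r' x)" "- s"] by simp
    finally show ?thesis .
  qed
  moreover have "0 \<le> M * (LINT x|lborel. norm (r' x))" using M by simp
  ultimately show ?thesis using that by blast
qed

text \<open>
  The majorant depends on \<open>t - s\<close> alone and is integrable, which yields the contraction property;
  it inherits the power bounds of the \<open>q\<^sub>j\<close>, which yields the kernel estimate of the theorem.
\<close>

lemma GL'_majorant:
  obtains P D where "\<And>j. j \<in> {1..N} \<Longrightarrow> 0 \<le> P j" "0 \<le> D"
    "\<And>t s. norm (GL' t s) \<le> (\<Sum>j=1..N. P j * norm (q' j (t - s))) + D * indicator {0<..T} (t - s)"
proof -
  obtain D where D: "0 \<le> D" "\<And>t s. norm (bounded_part t s) \<le> D" using bounded_part_bounded by blast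
  have "\<forall>j\<in>{1..N}. \<exists>M. 0 \<le> M \<and> (\<forall>t. norm (p j t) \<le> M)"
    using cont_space_bounded[OF p_cont] by metis
  then obtain P where P: "\<And>j. j \<in> {1..N} \<Longrightarrow> 0 \<le> P j" "\<And>j t. j \<in> {1..N} \<Longrightarrow> norm (p j t) \<le> P j"
    by metis
  have "norm (GL' t s) \<le> (\<Sum>j=1..N. P j * norm (q' j (t - s))) + D * indicator {0<..T} (t - s)" for t s
  proof (cases "0 \<le> s \<and> s < t \<and> t \<le> T")
    case True
    have "norm (GL' t s) \<le> (\<Sum>j=1..N. norm (p j t * q' j (t - s))) + norm (bounded_part t s)"
      using True unfolding GL'_def by (simp add: norm_triangle_mono norm_sum)
    also have "\<dots> \<le> (\<Sum>j=1..N. P j * norm (q' j (t - s))) + D"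
      unfolding norm_mult by (intro add_mono sum_mono mult_right_mono P D) auto
    finally show ?thesis using True by simp
  next
    case False
    then show ?thesis using P(1) D(1) by (auto simp: GL'_def intro!: add_nonneg_nonneg sum_nonneg)
  qed
  then show ?thesis using that P(1) D(1) by blast
qed

lemma GL'_contraction:
  obtains \<beta> where "0 \<le> \<beta>" "weighted_contraction_kernel GL' (\<lambda>t. exp (\<beta> * t)) (1 / 2)"
proof -
  obtain P D where PD: "\<And>j. j \<in> {1..N} \<Longrightarrow> 0 \<le> P j" "0 \<le> D"
    "\<And>t s. norm (GL' t s) \<le> (\<Sum>j=1..N. P j * norm (q' j (t - s))) + D * indicator {0<..T} (t - s)"
    using GL'_majorant by blast
  let ?g = "\<lambda>x. (\<Sum>j=1..N. P j * norm (q' j x)) + D * indicator {0<..T} x"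
  have "integrable lborel ?g"
    using T_pos
    by (intro Bochner_Integration.integrable_add Bochner_Integration.integrable_sum
        integrable_mult_right integrable_norm q'_int) auto
  moreover have "?g x = 0" if "x \<le> 0" for x
    using that q'_supp by (auto intro!: sum.neutral)
  ultimately show ?thesis
    using convolution_majorant_imp_contraction[OF GL'_meas, of ?g] PD(3) that by blast
qed

lemma GL'_op_decompose:
  assumes f: "f \<in> cont_space T" and t: "t \<in> {0..T}"
  shows "kernel_op GL' f t = (\<Sum>j=1..N. p j t * kernel_op (\<lambda>t s. q' j (t - s)) f t)
    + kernel_op K' (kernel_op (\<lambda>t s. r' (t - s)) f) t"
proof -
  note [measurable] = cont_space_measurable[OF f]
  obtain M where M: "0 \<le> M" "\<And>t. norm (f t) \<le> M" using cont_space_bounded[OF f] by blast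
  obtain Mk where Mk: "0 \<le> Mk" "\<And>t s. norm (K' t s) \<le> Mk" using triangle_extension_bounded[OF K_cont] by blast
  obtain D where D: "0 \<le> D" "\<And>t s. norm (bounded_part t s) \<le> D" using bounded_part_bounded by blast
  have int_q: "integrable lborel (\<lambda>s. q' j (t - s) * f s)" if j: "j \<in> {1..N}" for j
  proof -
    note [measurable] = q'_meas[OF j]
    have "integrable lborel (\<lambda>s. M * norm (q' j (t - s)))"
      using lborel_integrable_real_affine[OF q'_int[OF j], of "-1" t] by simp
    then show ?thesis
      by (rule Bochner_Integration.integrable_bound)
         (auto simp: norm_mult mult.commute[of M] M intro!: mult_left_mono)
  qed
  have int_s: "integrable lborel (\<lambda>s. bounded_part t s * f s)"
  proof (rule Bochner_Integration.integrable_bound)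
    show "integrable lborel (\<lambda>s. D * norm (f s))" using cont_space_integrable[OF f] by simp
  qed (auto simp: norm_mult D intro!: mult_right_mono)
  have bounded_part_0: "bounded_part t s = 0" if "t \<le> s" for s
  proof -
    have "K' t \<xi> * r' (\<xi> - s) = 0" for \<xi>
      using that r'_supp[of "\<xi> - s"] by (cases "t < \<xi>") (auto simp: triangle_extension_def)
    then show ?thesis unfolding bounded_part_def by (simp only: integral_zero)
  qed
  have "GL' t s * f s = (\<Sum>j=1..N. p j t * (q' j (t - s) * f s)) + bounded_part t s * f s" for s
  proof -
    \<comment> \<open>Off the triangle both sides vanish: \<open>f\<close> for \<open>s < 0\<close>, and \<open>q'\<close> and the bounded part for \<open>t \<le> s\<close>.\<close>
    consider "0 \<le> s" "s < t" | "s < 0" | "t \<le> s" by linarith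
    then show ?thesis
    proof cases
      case 1
      then show ?thesis using t by (simp add: GL'_def distrib_right sum_distrib_right mult.assoc)
    next
      case 2
      then show ?thesis using cont_space_zero[OF f, of s] by simp
    next
      case 3
      then have "q' j (t - s) = 0" if "j \<in> {1..N}" for j using q'_supp[OF that] by auto
      then show ?thesis using 3 by (simp add: GL'_def bounded_part_0)
    qed
  qed
  then have "kernel_op GL' f t =
      (LINT s|lborel. (\<Sum>j=1..N. p j t * (q' j (t - s) * f s)) + bounded_part t s * f s)"
    by (simp add: kernel_op_def)
  also have "\<dots> = (LINT s|lborel. (\<Sum>j=1..N. p j t * (q' j (t - s) * f s))) + kernel_op bounded_part f t"
    unfolding kernel_op_def
    by (intro Bochner_Integration.integral_add Bochner_Integration.integrable_sum integrable_mult_right int_q int_s)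
  also have "(LINT s|lborel. (\<Sum>j=1..N. p j t * (q' j (t - s) * f s)))
      = (\<Sum>j=1..N. LINT s|lborel. p j t * (q' j (t - s) * f s))"
    by (intro Bochner_Integration.integral_sum integrable_mult_right int_q)
  also have "\<dots> = (\<Sum>j=1..N. p j t * kernel_op (\<lambda>t s. q' j (t - s)) f t)"
    by (simp add: kernel_op_def)
  also have "kernel_op bounded_part f t = kernel_op K' (kernel_op (\<lambda>t s. r' (t - s)) f) t"
    unfolding bounded_part_def[abs_def]
  proof (rule kernel_op_compose)
    let ?R = "LINT x|lborel. norm (r' x)"
    have inner: "(\<integral>\<^sup>+s. norm (r' (\<xi> - s) * f s) \<partial>lborel) \<le> ennreal (M * ?R)" for \<xi>
    proof -
      have "(\<integral>\<^sup>+s. norm (r' (\<xi> - s) * f s) \<partial>lborel) \<le> (\<integral>\<^sup>+s. ennreal M * norm (r' (\<xi> - s)) \<partial>lborel)"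
        using M by (intro nn_integral_mono)
          (auto simp: norm_mult mult.commute[of _ "norm (f _)"] ennreal_mult[symmetric] intro!: ennreal_leI mult_right_mono)
      also have "\<dots> = ennreal M * (\<integral>\<^sup>+s. norm (r' (\<xi> - s)) \<partial>lborel)"
        by (rule nn_integral_cmult) measurable
      also have "(\<integral>\<^sup>+s. norm (r' (\<xi> - s)) \<partial>lborel) = (\<integral>\<^sup>+x. norm (r' x) \<partial>lborel)"
        using nn_integral_real_affine[of "\<lambda>x. ennreal (norm (r' x))" "-1" \<xi>] by simp
      also have "\<dots> = ennreal ?R"
        using r'_int by (intro nn_integral_eq_integral) auto
      finally show ?thesis using M(1) by (simp add: ennreal_mult)
    qed
    have "(\<integral>\<^sup>+\<xi>. norm (K' t \<xi>) * (\<integral>\<^sup>+s. norm (r' (\<xi> - s) * f s) \<partial>lborel) \<partial>lborel)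
        \<le> (\<integral>\<^sup>+\<xi>. ennreal Mk * ennreal (M * ?R) * indicator {0..T} \<xi> \<partial>lborel)"
    proof (rule nn_integral_mono)
      fix \<xi>
      have "ennreal (norm (K' t \<xi>)) \<le> ennreal Mk * indicator {0..T} \<xi>"
        using Mk(2)[of t \<xi>] t by (cases "\<xi> \<in> {0..T}") (auto simp: ennreal_leI triangle_extension_def)
      from mult_mono[OF this inner[of \<xi>]]
      show "norm (K' t \<xi>) * (\<integral>\<^sup>+s. norm (r' (\<xi> - s) * f s) \<partial>lborel)
          \<le> ennreal Mk * ennreal (M * ?R) * indicator {0..T} \<xi>"
        by (simp add: mult_ac)
    qed
    also have "\<dots> < \<infinity>"
      using T_pos by (subst nn_integral_cmult) (auto simp: ennreal_mult_less_top)
    finally show "(\<integral>\<^sup>+\<xi>. norm (K' t \<xi>) * (\<integral>\<^sup>+s. norm (r' (\<xi> - s) * f s) \<partial>lborel) \<partial>lborel) < \<infinity>" .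
  qed measurable
  finally show ?thesis .
qed

lemma conv_q: "j \<in> {1..N} \<Longrightarrow> f \<in> cont_space T \<Longrightarrow> t \<in> {0..T} \<Longrightarrow>
    conv_op T (q j) f t = kernel_op (\<lambda>t s. q' j (t - s)) f t"
  by (rule conv_op_eq_kernel_op[OF q'_int q'_supp q_eq])

lemma conv_r: "f \<in> cont_space T \<Longrightarrow> t \<in> {0..T} \<Longrightarrow> conv_op T r f t = kernel_op (\<lambda>t s. r' (t - s)) f t"
  by (rule conv_op_eq_kernel_op[OF r'_int r'_supp r_eq])

lemma conv_r_cont_space:
  assumes "f \<in> cont_space T"
  shows "conv_op T r f \<in> cont_space T"
proof (rule cont_spaceI)
  have "continuous_on {0..T} (kernel_op (\<lambda>t s. r' (t - s)) f)"
    using continuous_convolution[OF r'_int assms] by (rule continuous_on_subset) simp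
  then show "continuous_on {0..T} (conv_op T r f)"
    by (rule continuous_on_eq) (simp add: conv_r[OF assms])
qed (unfold conv_op_def, rule volterra_op_outside)

lemma volterra_K:
  assumes f: "f \<in> cont_space T" and t: "t \<in> {0..T}"
  shows "volterra_op T K f t = kernel_op K' f t"
proof (rule volterra_op_eq_kernel_op[OF t _ cont_space_measurable[OF f]])
  show "K' t s * f s = 0" if "s \<notin> {0..t}" for s using that by (auto simp: triangle_extension_def)
qed (use t in \<open>auto simp: triangle_extension_def intro: measurable_Pair2'\<close>)

text \<open>
  The identity that turns the equation \<open>Lu = f\<close> into one of the second kind: with \<open>u = Rg\<close> the terms
  of \<open>Lu\<close> other than \<open>Au = g\<close> add up to the Volterra operator of \<open>G\<^sub>L\<close> applied to \<open>g\<close>.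
\<close>

lemma volterra_GL:
  assumes f: "f \<in> cont_space T"
  shows "volterra_op T (kernel_GL r N p q K) f t
    = (\<Sum>j=1..N. p j t * conv_op T (q j) f t) + volterra_op T K (conv_op T r f) t"
proof (cases "t \<in> {0..T}")
  case True
  have "volterra_op T (kernel_GL r N p q K) f t = kernel_op GL' f t"
    using True cont_space_measurable[OF f] GL_rows[OF True]
    by (intro volterra_op_eq_kernel_op) (auto simp: GL'_def)
  also have "\<dots> = (\<Sum>j=1..N. p j t * conv_op T (q j) f t) + kernel_op K' (kernel_op (\<lambda>t s. r' (t - s)) f) t"
    using GL'_op_decompose[OF f True] by (simp add: conv_q[OF _ f True])
  also have "kernel_op K' (kernel_op (\<lambda>t s. r' (t - s)) f) t = kernel_op K' (conv_op T r f) t"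
    unfolding kernel_op_def[of K']
    by (rule Bochner_Integration.integral_cong) (auto simp: triangle_extension_def conv_r[OF f])
  finally show ?thesis using volterra_K[OF conv_r_cont_space[OF f] True] by simp
next
  case False
  then show ?thesis by (simp add: conv_op_def volterra_op_outside)
qed

lemma volterra_GL_cont_space:
  assumes f: "f \<in> cont_space T"
  shows "volterra_op T (kernel_GL r N p q K) f \<in> cont_space T"
proof (rule cont_spaceI)
  have "continuous_on {0..T} (\<lambda>t. (\<Sum>j=1..N. p j t * kernel_op (\<lambda>t s. q' j (t - s)) f t)
      + kernel_op K' (conv_op T r f) t)"
  proof (intro continuous_intros)
    show "continuous_on {0..T} (p j)" if "j \<in> {1..N}" for j
      using p_cont[OF that] by (simp add: cont_space_def)
    show "continuous_on {0..T} (kernel_op (\<lambda>t s. q' j (t - s)) f)" if "j \<in> {1..N}" for j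
      using continuous_convolution[OF q'_int[OF that] f] by (rule continuous_on_subset) simp
    show "continuous_on {0..T} (kernel_op K' (conv_op T r f))"
      by (rule continuous_volterra[OF K_cont conv_r_cont_space[OF f]])
  qed
  then show "continuous_on {0..T} (volterra_op T (kernel_GL r N p q K) f)"
    by (rule continuous_on_eq)
       (simp add: volterra_GL[OF f] conv_q[OF _ f] volterra_K[OF conv_r_cont_space[OF f]])
qed (rule volterra_op_outside)

lemma volterra_kernel_GL:
  assumes q_bound: "\<And>j. j \<in> {1..N} \<Longrightarrow> power_bounded T (q j)"
  shows "volterra_kernel T (kernel_GL r N p q K)"
  unfolding volterra_kernel_def
proof (intro conjI)
  let ?S = "strict_triangle T"
  have S: "?S \<in> sets borel"
  proof -
    have "?S = {z. 0 \<le> snd z} \<inter> {z. snd z < fst z} \<inter> {z. fst z \<le> T}"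
      by (auto simp: strict_triangle_def)
    also have "\<dots> \<in> sets borel"
      by (intro sets.Int borel_closed borel_open closed_Collect_le open_Collect_less continuous_intros)
    finally show ?thesis .
  qed
  have "case_prod GL' \<in> borel_measurable lebesgue"
    using GL'_meas by (intro measurable_completion) (simp add: borel_prod)
  moreover have "AE z in lborel. case_prod GL' z = (if z \<in> ?S then case_prod (kernel_GL r N p q K) z else 0)"
    using GL_triangle by eventually_elim (auto simp: strict_triangle_def intro: GL'_outside)
  ultimately have "(\<lambda>z. if z \<in> ?S then case_prod (kernel_GL r N p q K) z else 0) \<in> borel_measurable lebesgue"
    by (rule borel_measurable_AE[OF _ AE_completion])
  then show "(\<lambda>(t, s). kernel_GL r N p q K t s) \<in> borel_measurable (lebesgue_on ?S)"
    by (rule borel_measurable_if_D)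
  show "volterra_op T (kernel_GL r N p q K) ` cont_space T \<subseteq> cont_space T"
    using volterra_GL_cont_space by blast
  obtain P D where PD: "\<And>j. j \<in> {1..N} \<Longrightarrow> 0 \<le> P j" "0 \<le> D"
    "\<And>t s. norm (GL' t s) \<le> (\<Sum>j=1..N. P j * norm (q' j (t - s))) + D * indicator {0<..T} (t - s)"
    using GL'_majorant by blast
  let ?g = "\<lambda>x. (\<Sum>j=1..N. of_real (P j * norm (q' j x))) + complex_of_real D"
  have "power_bounded T ?g"
    by (intro power_bounded_add power_bounded_sum power_bounded_mult_norm power_bounded_const PD
        power_bounded_cong_AE[OF q_bound q_eq]) auto
  then obtain C \<eta> where pos: "0 < C" "0 < \<eta>"
    and ae: "AE x in lborel. 0 < x \<and> x < T \<longrightarrow> norm (?g x) \<le> C * x powr (\<eta> - 1)"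
    unfolding power_bounded_iff_lborel by blast
  have le: "norm (GL' t s) \<le> norm (?g (t - s))" for t s
  proof -
    have "norm (GL' t s) \<le> (\<Sum>j=1..N. P j * norm (q' j (t - s))) + D"
      using PD(3)[of t s] mult_left_mono[OF indicator_le_1 PD(2), of "{0<..T}" "t - s"] by simp
    also have "\<dots> \<le> norm (complex_of_real \<dots>)" by (simp only: norm_of_real abs_ge_self)
    finally show ?thesis by simp
  qed
  \<comment> \<open>The triangle contains the point \<open>(T, 0)\<close>, where \<open>t - s = T\<close> lies outside the open interval.\<close>
  have "AE x in lborel. 0 < x \<and> x \<le> T \<longrightarrow> norm (?g x) \<le> C * x powr (\<eta> - 1)"
    using ae AE_lborel_singleton[of T] by eventually_elim auto
  from AE_lborel_difference[OF this] GL_triangle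
  have "AE z in lborel. z \<in> ?S \<longrightarrow>
      (case z of (t, s) \<Rightarrow> norm (kernel_GL r N p q K t s) \<le> C * (t - s) powr (\<eta> - 1))"
  proof eventually_elim
    case (elim z)
    obtain t s where z: "z = (t, s)" by (cases z)
    show ?case
      using elim le[of t s] unfolding z by (auto simp: strict_triangle_def)
  qed
  then have "AE z in lebesgue. z \<in> ?S \<longrightarrow>
      (case z of (t, s) \<Rightarrow> norm (kernel_GL r N p q K t s) \<le> C * (t - s) powr (\<eta> - 1))"
    by (rule AE_completion)
  then have "AE (t, s) in lebesgue_on ?S. norm (kernel_GL r N p q K t s) \<le> C * (t - s) powr (\<eta> - 1)"
    using S by (subst AE_restrict_space_iff) auto
  with pos show "\<exists>C>0. \<exists>\<eta>>0. AE (t, s) in lebesgue_on ?S. norm (kernel_GL r N p q K t s) \<le> C * (t - s) powr (\<eta> - 1)"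
    by blast
qed

lemma modelled_kernel_GL:
  obtains \<beta> where "modelled_volterra_kernel T (kernel_GL r N p q K) GL' \<beta>"
proof -
  obtain \<beta> where "0 \<le> \<beta>" "weighted_contraction_kernel GL' (\<lambda>t. exp (\<beta> * t)) (1 / 2)"
    using GL'_contraction by blast
  then have "modelled_volterra_kernel T (kernel_GL r N p q K) GL' \<beta>"
    by (intro modelled_volterra_kernel.intro GL_rows GL_columns GL'_meas GL'_outside)
       (auto intro: volterra_GL_cont_space)
  then show ?thesis using that by blast
qed

end

theorem theorem2:
  fixes T :: real and r :: "real \<Rightarrow> complex" and N :: nat
    and p q :: "nat \<Rightarrow> real \<Rightarrow> complex"
    and B :: "nat \<Rightarrow> (real \<Rightarrow> complex) \<Rightarrow> real \<Rightarrow> complex"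
    and K :: "real \<Rightarrow> real \<Rightarrow> complex"
  assumes "T > 0"
    and "admissible_causal_inverse T r"
    and "\<And>j. j \<in> {1..N} \<Longrightarrow> linear_operator_on (dom_A T r) (B j)"
    and "\<And>j g. j \<in> {1..N} \<Longrightarrow> g \<in> cont_space T \<Longrightarrow> B j (conv_op T r g) = conv_op T (q j) g"
    and "\<And>j. j \<in> {1..N} \<Longrightarrow> q j absolutely_integrable_on {0<..<T}"
    and "\<And>j. j \<in> {1..N} \<Longrightarrow> power_bounded T (q j)"
    and "\<And>j. j \<in> {1..N} \<Longrightarrow> p j \<in> cont_space T"
    and "continuous_on (closed_triangle T) (\<lambda>(t, s). K t s)"
  shows "volterra_kernel T (kernel_GL r N p q K) \<and>
    (\<forall>f \<in> cont_space T.
       (\<exists>!u. u \<in> dom_A T r \<and> op_L T r N p B K u = f) \<and>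
       (\<forall>u \<in> dom_A T r. op_L T r N p B K u = f \<longrightarrow>
          u = conv_op T r
                (\<lambda>t. f t - volterra_op T (resolvent_kernel (kernel_GL r N p q K)) f t)))"
proof -
  let ?G = "kernel_GL r N p q K"
  have r_int: "r absolutely_integrable_on {0<..<T}" and r_inj: "inj_on (conv_op T r) (cont_space T)"
    using assms(2) by (auto simp: admissible_causal_inverse_def)
  obtain r' where r': "integrable lborel r'" "\<And>x. x \<notin> {0<..<T} \<Longrightarrow> r' x = 0"
    "AE x in lborel. x \<in> {0<..<T} \<longrightarrow> r x = r' x"
    by (rule borel_representative[OF r_int]) blast
  have "\<forall>j\<in>{1..N}. \<exists>h. integrable lborel h \<and> (\<forall>x. x \<notin> {0<..<T} \<longrightarrow> h x = 0) \<and>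
      (AE x in lborel. x \<in> {0<..<T} \<longrightarrow> q j x = h x)"
  proof
    fix j assume "j \<in> {1..N}"
    then show "\<exists>h. integrable lborel h \<and> (\<forall>x. x \<notin> {0<..<T} \<longrightarrow> h x = 0) \<and>
        (AE x in lborel. x \<in> {0<..<T} \<longrightarrow> q j x = h x)"
      by (rule borel_representative[OF assms(5)]) blast
  qed
  from bchoice[OF this] obtain q' where q': "\<And>j. j \<in> {1..N} \<Longrightarrow> integrable lborel (q' j)"
    "\<And>j x. j \<in> {1..N} \<Longrightarrow> x \<notin> {0<..<T} \<Longrightarrow> q' j x = 0"
    "\<And>j. j \<in> {1..N} \<Longrightarrow> AE x in lborel. x \<in> {0<..<T} \<longrightarrow> q j x = q' j x"
    by blast
  interpret causal_equation_data T r r' N p q q' K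
    by unfold_locales (fact assms r' q')+
  obtain \<beta> where "modelled_volterra_kernel T ?G GL' \<beta>" using modelled_kernel_GL by blast
  then interpret modelled_volterra_kernel T ?G GL' \<beta> .
  have L_eq: "op_L T r N p B K (conv_op T r g) = (\<lambda>t. g t + volterra_op T ?G g t)"
    if g: "g \<in> cont_space T" for g
  proof -
    have "op_A T r (conv_op T r g) = g"
      unfolding op_A_def by (rule inv_into_f_f[OF r_inj g])
    then show ?thesis
      unfolding op_L_def by (simp add: volterra_GL[OF g] assms(4)[OF _ g] add.assoc)
  qed
  have formula: "u = conv_op T r (\<lambda>t. f t - volterra_op T (resolvent_kernel ?G) f t)"
    if f: "f \<in> cont_space T" and u: "u \<in> dom_A T r" "op_L T r N p B K u = f" for f u
  proof -
    from u(1) obtain g where g: "g \<in> cont_space T" "u = conv_op T r g" by (auto simp: dom_A_def)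
    then have "g = (\<lambda>t. f t - volterra_op T (resolvent_kernel ?G) f t)"
      using u(2) L_eq by (intro second_kind_solution_unique f) auto
    with g(2) show ?thesis by simp
  qed
  have "\<exists>u. u \<in> dom_A T r \<and> op_L T r N p B K u = f" if f: "f \<in> cont_space T" for f
  proof -
    obtain g where "g \<in> cont_space T" "(\<lambda>t. g t + volterra_op T ?G g t) = f"
      by (rule second_kind_solution_exists[OF f])
    then show ?thesis using L_eq by (auto simp: dom_A_def)
  qed
  then show ?thesis
    using volterra_kernel_GL[OF assms(6)] formula by blast
qed

end
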